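(* Every commutative associative algebra of dimension $4$ over $\mathbb{C}$ (equivalently, every $4$-dimensional Novikov algebra over $\mathbb{C}$ with abelian associated Lie algebra) is isomorphic to exactly one algebra in the following list. Each algebra has basis $e_1,e_2,e_3,e_4$, and only the nonzero products of basis elements are listed, up to commutativity. 1. all products zero; 2. $e_1^2=e_2$; 3. $e_1^2=e_3$, $e_2^2=e_3$; 4. $e_1^2=e_2$, $e_1e_2=e_3$; 5. $e_1^2=-e_3$, $e_1e_2=e_4$, $e_2^2=e_3$; 6. $e_1e_2=e_4$, $e_2^2=e_3$; 7. $e_1^2=e_4$, $e_2^2=e_4$, $e_3^2=e_4$; 8. $e_1^2=e_2$, $e_1e_2=e_4$, $e_3^2=e_4$; 9. $e_1^2=e_2$, $e_1e_2=e_3$, $e_1e_3=e_4$, $e_2^2=e_4$; 10. $e_1^2=e_1$, $e_2^2=e_2$, $e_3^2=e_3$, $e_4^2=e_4$; 11. $e_1^2=e_1$, $e_2^2=e_2$, $e_3^2=e_3$, $e_3e_4=e_4$; 12. $e_1^2=e_1$, $e_1e_2=e_2$, $e_3^2=e_3$, $e_3e_4=e_4$; 13. $e_1^2=e_1$, $e_2^2=e_2$, $e_2e_3=e_3$, $e_2e_4=e_4$; 14. $e_1^2=e_1$, $e_2^2=e_2$, $e_2e_3=e_3$, $e_2e_4=e_4$, $e_3^2=e_4$; 15. $e_1^2=e_1$, $e_1e_2=e_2$, $e_1e_3=e_3$, $e_1e_4=e_4$; 16. $e_1^2=e_1$, $e_1e_2=e_2$, $e_1e_3=e_3$, $e_1e_4=e_4$,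 $e_2^2=e_3$; 17. $e_1^2=e_1$, $e_1e_2=e_2$, $e_1e_3=e_3$, $e_1e_4=e_4$, $e_2^2=e_3$, $e_2e_3=e_4$; 18. $e_1^2=e_1$, $e_1e_2=e_2$, $e_1e_3=e_3$, $e_1e_4=e_4$, $e_2^2=e_4$, $e_3^2=e_4$; 19. $e_1^2=e_1$, $e_2^2=e_2$, $e_3^2=e_3$; 20. $e_1^2=e_1$, $e_2^2=e_2$, $e_2e_3=e_3$; 21. $e_1^2=e_1$, $e_1e_2=e_2$, $e_1e_3=e_3$; 22. $e_1^2=e_1$, $e_1e_2=e_2$, $e_1e_3=e_3$, $e_2^2=e_3$; 23. $e_1^2=e_1$, $e_2^2=e_2$; 24. $e_1^2=e_1$, $e_2^2=e_2$, $e_3^2=e_4$; 25. $e_1^2=e_1$, $e_1e_2=e_2$; 26. $e_1^2=e_1$, $e_1e_2=e_2$, $e_3^2=e_4$; 27. $e_1^2=e_1$; 28. $e_1^2=e_1$, $e_2e_3=e_4$; 29. $e_1^2=e_1$, $e_2^2=e_3$; 30. $e_1^2=e_1$, $e_2^2=e_3$, $e_2e_3=e_4$. Conversely, all algebras in the list are commutative and associative.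
   Context: Algebras are not assumed to have an identity element. A Novikov algebra is a vector space with bilinear product satisfying $x(yz)-(xy)z=y(xz)-(yx)z$ and $(xy)z=(xz)y$ for all $x,y,z$; its associated Lie algebra has bracket $[x,y]=xy-yx$. A Novikov algebra has abelian associated Lie algebra if and only if it is commutative and associative. *)

theory Defs
  imports "HOL-Analysis.Analysis"
begin

locale complex_algebra = vector_space scale
  for scale :: "complex \<Rightarrow> 'a::ab_group_add \<Rightarrow> 'a" +
  fixes mul :: "'a \<Rightarrow> 'a \<Rightarrow> 'a"
  assumes linear_left: "Vector_Spaces.linear scale scale (\<lambda>x. mul x y)"
    and linear_right: "Vector_Spaces.linear scale scale (mul x)"

locale comm_assoc_algebra = complex_algebra +
  assumes comm: "mul x y = mul y x"
    and assoc: "mul (mul x y) z = mul x (mul y z)"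

locale novikov_algebra = complex_algebra +
  assumes left_symmetric:
      "mul x (mul y z) - mul (mul x y) z = mul y (mul x z) - mul (mul y x) z"
    and right_commute: "mul (mul x y) z = mul (mul x z) y"

definition lie_bracket :: "('a::ab_group_add \<Rightarrow> 'a \<Rightarrow> 'a) \<Rightarrow> 'a \<Rightarrow> 'a \<Rightarrow> 'a" where
  "lie_bracket mul x y = mul x y - mul y x"

definition abelian_lie :: "('a::ab_group_add \<Rightarrow> 'a \<Rightarrow> 'a) \<Rightarrow> bool" where
  "abelian_lie mul \<longleftrightarrow> (\<forall>x y. lie_bracket mul x y = 0)"

definition isomorphic_algebras ::
  "(complex \<Rightarrow> 'a::ab_group_add \<Rightarrow> 'a) \<Rightarrow> ('a \<Rightarrow> 'a \<Rightarrow> 'a)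
    \<Rightarrow> (complex \<Rightarrow> 'b::ab_group_add \<Rightarrow> 'b) \<Rightarrow> ('b \<Rightarrow> 'b \<Rightarrow> 'b) \<Rightarrow> bool" where
  "isomorphic_algebras s1 m1 s2 m2 \<longleftrightarrow>
     (\<exists>f. Vector_Spaces.linear s1 s2 f \<and> bij f \<and> (\<forall>x y. f (m1 x y) = m2 (f x) (f y)))"

(* The index type 4 is the integers modulo 4, so its four elements are 1, 2, 3 and 4 = 0. *)
definition ee :: "4 \<Rightarrow> complex ^ 4" where
  "ee i = axis i 1"

type_synonym product_table = "((4 \<times> 4) \<times> (complex ^ 4)) list"

(* An entry ((i, j), v) stands for e_i e_j = e_j e_i = v; products not covered are zero. *)
definition basis_product :: "product_table \<Rightarrow> 4 \<Rightarrow> 4 \<Rightarrow> complex ^ 4" where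
  "basis_product T i j =
     (case map_of T (i, j) of Some v \<Rightarrow> v
      | None \<Rightarrow> (case map_of T (j, i) of Some v \<Rightarrow> v | None \<Rightarrow> 0))"

definition table_mult :: "product_table \<Rightarrow> complex ^ 4 \<Rightarrow> complex ^ 4 \<Rightarrow> complex ^ 4" where
  "table_mult T x y = (\<Sum>i\<in>UNIV. \<Sum>j\<in>UNIV. (x $ i * y $ j) *s basis_product T i j)"

definition product_tables :: "product_table list" where
  "product_tables = [
     [],
     [((1,1), ee 2)],
     [((1,1), ee 3), ((2,2), ee 3)],
     [((1,1), ee 2), ((1,2), ee 3)],
     [((1,1), - ee 3), ((1,2), ee 4), ((2,2), ee 3)],
     [((1,2), ee 4), ((2,2), ee 3)],
     [((1,1), ee 4), ((2,2), ee 4), ((3,3), ee 4)],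
     [((1,1), ee 2), ((1,2), ee 4), ((3,3), ee 4)],
     [((1,1), ee 2), ((1,2), ee 3), ((1,3), ee 4), ((2,2), ee 4)],
     [((1,1), ee 1), ((2,2), ee 2), ((3,3), ee 3), ((4,4), ee 4)],
     [((1,1), ee 1), ((2,2), ee 2), ((3,3), ee 3), ((3,4), ee 4)],
     [((1,1), ee 1), ((1,2), ee 2), ((3,3), ee 3), ((3,4), ee 4)],
     [((1,1), ee 1), ((2,2), ee 2), ((2,3), ee 3), ((2,4), ee 4)],
     [((1,1), ee 1), ((2,2), ee 2), ((2,3), ee 3), ((2,4), ee 4), ((3,3), ee 4)],
     [((1,1), ee 1), ((1,2), ee 2), ((1,3), ee 3), ((1,4), ee 4)],
     [((1,1), ee 1), ((1,2), ee 2), ((1,3), ee 3), ((1,4), ee 4), ((2,2), ee 3)],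
     [((1,1), ee 1), ((1,2), ee 2), ((1,3), ee 3), ((1,4), ee 4), ((2,2), ee 3), ((2,3), ee 4)],
     [((1,1), ee 1), ((1,2), ee 2), ((1,3), ee 3), ((1,4), ee 4), ((2,2), ee 4), ((3,3), ee 4)],
     [((1,1), ee 1), ((2,2), ee 2), ((3,3), ee 3)],
     [((1,1), ee 1), ((2,2), ee 2), ((2,3), ee 3)],
     [((1,1), ee 1), ((1,2), ee 2), ((1,3), ee 3)],
     [((1,1), ee 1), ((1,2), ee 2), ((1,3), ee 3), ((2,2), ee 3)],
     [((1,1), ee 1), ((2,2), ee 2)],
     [((1,1), ee 1), ((2,2), ee 2), ((3,3), ee 4)],
     [((1,1), ee 1), ((1,2), ee 2)],
     [((1,1), ee 1), ((1,2), ee 2), ((3,3), ee 4)],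
     [((1,1), ee 1)],
     [((1,1), ee 1), ((2,3), ee 4)],
     [((1,1), ee 1), ((2,2), ee 3)],
     [((1,1), ee 1), ((2,2), ee 3), ((2,3), ee 4)]]"

(* The numbering of the list starts at 1. *)
definition listed_mult :: "nat \<Rightarrow> complex ^ 4 \<Rightarrow> complex ^ 4 \<Rightarrow> complex ^ 4" where
  "listed_mult n = table_mult (product_tables ! (n - 1))"

end

theory Submission
  imports Defs "HOL-Computational_Algebra.Fundamental_Theorem_Algebra"
begin

text \<open>
A finite-dimensional commutative associative algebra over \<open>\<complex>\<close> is a direct product of local unital
algebras and a nilpotent algebra, and a local unital algebra is \<open>\<complex>1 \<oplus> M\<close> with \<open>M\<close> nilpotent. So
the classification in dimension four follows from that of the nilpotent algebras of dimension at
most four: there are \<open>1, 1, 2, 4, 9\<close> of them in dimensions \<open>0, 1, 2, 3, 4\<close>, and distributing the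
dimensions over the factors gives \<open>9 + 4 + 2 \<cdot> 2 + 1 \<cdot> 4 + 9 = 30\<close> algebras, where \<open>1, 1, 2, 4, 9\<close>
also counts the unital algebras of dimension \<open>0\<close> to \<open>4\<close>.

The product decomposition is obtained one factor at a time (\<open>local_splitting\<close>). An element \<open>x\<close> that is
not nilpotent has a nonzero idempotent multiple, because the images of the powers of multiplication
by \<open>x\<close> become stationary. An idempotent \<open>e\<close> for which \<open>eA\<close> has least dimension is primitive; on \<open>eA\<close>
every multiplication operator has an eigenvalue \<open>c\<close>, and \<open>x - ce\<close> must be nilpotent since
otherwise it would be invertible in \<open>eA\<close> in spite of its kernel. Hence \<open>A = \<complex>e \<oplus> M \<oplus> W\<close> with \<open>M\<close>
the nilpotent part of \<open>eA\<close> and \<open>W\<close> the annihilator of \<open>e\<close>, and one continues with \<open>W\<close>.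

A nilpotent algebra \<open>N\<close> is sorted by the largest nonvanishing power of its elements
(\<open>nilpotent_classification\<close>). If that power is as large as the dimension allows, \<open>N\<close> is generated by one
element. If all cubes vanish, polarization gives \<open>N\<^sup>3 = 0\<close>, so the product is a symmetric bilinear map
on \<open>N / N\<^sup>2\<close>; it is either one quadratic form, which is diagonalized, or a pencil of binary
quadratic forms, which is determined by the rank of the one quadratic relation between the products.
Only dimension four with a nonzero cube and vanishing fourth powers remains
(\<open>third_power_presented\<close>).

All normal forms are recorded as bases in which a product of two basis vectors is a basis vector or
zero, so that the assembly of the factors and the comparison with the list are computations with
finite tables of natural numbers (\<open>presents_split\<close>, \<open>tables_identified\<close>). Only the algebras 5 and 28
need a further linear change of basis.

That the listed algebras are pairwise nonisomorphic is seen from the dimensions of five subspaces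
defined by the multiplication alone; those that are computed are coordinate planes in the listed bases
(\<open>listed_invariants_separate\<close>).
\<close>

section \<open>The listed algebras in coordinates\<close>

lemma table_mult_coords:
  "table_mult T x y $ k =
     (\<Sum>i\<leftarrow>[1,2,3,4]. \<Sum>j\<leftarrow>[1,2,3,4]. x $ i * y $ j * basis_product T i j $ k)"
  by (simp add: table_mult_def sum_4)

lemmas listed_coords = listed_mult_def product_tables_def table_mult_coords basis_product_def
  ee_def axis_def vec_eq_iff forall_4 nth_Cons'

text \<open>Multiplication formulas are evaluated on explicit quadruples: rewriting then computes inner products
first, which keeps iterated products of up to five vectors small.\<close>

definition V4 :: "complex \<Rightarrow> complex \<Rightarrow> complex \<Rightarrow> complex \<Rightarrow> complex ^ 4" where
  "V4 a b c d = (\<chi> i. if i = 1 then a else if i = 2 then b else if i = 3 then c else d)"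

lemma V4_nth [simp]: "V4 a b c d $ 1 = a" "V4 a b c d $ 2 = b" "V4 a b c d $ 3 = c" "V4 a b c d $ 4 = d"
  by (simp_all add: V4_def)

lemma V4_cases: obtains a b c d where "x = V4 a b c d"
proof
  show "x = V4 (x $ 1) (x $ 2) (x $ 3) (x $ 4)" by (simp add: vec_eq_iff forall_4)
qed

lemma V4_eq_0_iff: "V4 a b c d = 0 \<longleftrightarrow> a = 0 \<and> b = 0 \<and> c = 0 \<and> d = 0"
  by (simp add: vec_eq_iff forall_4)

lemma V4_add: "V4 a b c d + V4 a' b' c' d' = V4 (a + a') (b + b') (c + c') (d + d')"
  by (simp add: vec_eq_iff forall_4)

lemma ee_V4: "ee 1 = V4 1 0 0 0" "ee 2 = V4 0 1 0 0" "ee 3 = V4 0 0 1 0" "ee 4 = V4 0 0 0 1"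
  by (simp_all add: vec_eq_iff forall_4 ee_def axis_def)

lemma table_mult_add:
  "table_mult T (x + x') y = table_mult T x y + table_mult T x' y"
  "table_mult T x (y + y') = table_mult T x y + table_mult T x y'"
  by (simp_all add: vec_eq_iff table_mult_coords algebra_simps)

lemma table_mult_scale:
  "table_mult T (c *s x) y = c *s table_mult T x y"
  "table_mult T x (c *s y) = c *s table_mult T x y"
  by (simp_all add: vec_eq_iff table_mult_coords algebra_simps)

lemma table_mult_zero: "table_mult T 0 y = 0" "table_mult T x 0 = 0"
  by (simp_all add: vec_eq_iff table_mult_coords)

lemma listed_mult_V4:
  "listed_mult 1 (V4 a b c d) (V4 a' b' c' d') = V4 0 0 0 0"
  "listed_mult 2 (V4 a b c d) (V4 a' b' c' d') = V4 0 (a * a') 0 0"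
  "listed_mult 3 (V4 a b c d) (V4 a' b' c' d') = V4 0 0 (a * a' + b * b') 0"
  "listed_mult 4 (V4 a b c d) (V4 a' b' c' d') = V4 0 (a * a') (a * b' + b * a') 0"
  "listed_mult 5 (V4 a b c d) (V4 a' b' c' d') = V4 0 0 (-a * a' + b * b') (a * b' + b * a')"
  "listed_mult 6 (V4 a b c d) (V4 a' b' c' d') = V4 0 0 (b * b') (a * b' + b * a')"
  "listed_mult 7 (V4 a b c d) (V4 a' b' c' d') = V4 0 0 0 (a * a' + b * b' + c * c')"
  "listed_mult 8 (V4 a b c d) (V4 a' b' c' d') = V4 0 (a * a') 0 (a * b' + b * a' + c * c')"
  "listed_mult 9 (V4 a b c d) (V4 a' b' c' d') = V4 0 (a * a') (a * b' + b * a') (a * c' + b * b' + c * a')"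
  "listed_mult 10 (V4 a b c d) (V4 a' b' c' d') = V4 (a * a') (b * b') (c * c') (d * d')"
  "listed_mult 11 (V4 a b c d) (V4 a' b' c' d') = V4 (a * a') (b * b') (c * c') (c * d' + d * c')"
  "listed_mult 12 (V4 a b c d) (V4 a' b' c' d') = V4 (a * a') (a * b' + b * a') (c * c') (c * d' + d * c')"
  "listed_mult 13 (V4 a b c d) (V4 a' b' c' d') = V4 (a * a') (b * b') (b * c' + c * b') (b * d' + d * b')"
  "listed_mult 14 (V4 a b c d) (V4 a' b' c' d') = V4 (a * a') (b * b') (b * c' + c * b') (b * d' + c * c' + d * b')"
  "listed_mult 15 (V4 a b c d) (V4 a' b' c' d') = V4 (a * a') (a * b' + b * a') (a * c' + c * a') (a * d' + d * a')"
  "listed_mult 16 (V4 a b c d) (V4 a' b' c' d') = V4 (a * a') (a * b' + b * a') (a * c' + b * b' + c * a') (a * d' + d * a')"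
  "listed_mult 17 (V4 a b c d) (V4 a' b' c' d') = V4 (a * a') (a * b' + b * a') (a * c' + b * b' + c * a') (a * d' + b * c' + c * b' + d * a')"
  "listed_mult 18 (V4 a b c d) (V4 a' b' c' d') = V4 (a * a') (a * b' + b * a') (a * c' + c * a') (a * d' + b * b' + c * c' + d * a')"
  "listed_mult 19 (V4 a b c d) (V4 a' b' c' d') = V4 (a * a') (b * b') (c * c') 0"
  "listed_mult 20 (V4 a b c d) (V4 a' b' c' d') = V4 (a * a') (b * b') (b * c' + c * b') 0"
  "listed_mult 21 (V4 a b c d) (V4 a' b' c' d') = V4 (a * a') (a * b' + b * a') (a * c' + c * a') 0"
  "listed_mult 22 (V4 a b c d) (V4 a' b' c' d') = V4 (a * a') (a * b' + b * a') (a * c' + b * b' + c * a') 0"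
  "listed_mult 23 (V4 a b c d) (V4 a' b' c' d') = V4 (a * a') (b * b') 0 0"
  "listed_mult 24 (V4 a b c d) (V4 a' b' c' d') = V4 (a * a') (b * b') 0 (c * c')"
  "listed_mult 25 (V4 a b c d) (V4 a' b' c' d') = V4 (a * a') (a * b' + b * a') 0 0"
  "listed_mult 26 (V4 a b c d) (V4 a' b' c' d') = V4 (a * a') (a * b' + b * a') 0 (c * c')"
  "listed_mult 27 (V4 a b c d) (V4 a' b' c' d') = V4 (a * a') 0 0 0"
  "listed_mult 28 (V4 a b c d) (V4 a' b' c' d') = V4 (a * a') 0 0 (b * c' + c * b')"
  "listed_mult 29 (V4 a b c d) (V4 a' b' c' d') = V4 (a * a') 0 (b * b') 0"
  "listed_mult 30 (V4 a b c d) (V4 a' b' c' d') = V4 (a * a') 0 (b * b') (b * c' + c * b')"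
  by (simp_all add: listed_coords)

text \<open>Bilinearity holds for any table, whereas commutativity and associativity depend on the table.\<close>

lemma table_mult_complex_algebra: "complex_algebra (*s) (table_mult T)"
proof -
  have "Vector_Spaces.linear (*s) (*s) f" if "\<And>x y. f (x + y) = f x + f y" "\<And>c x. f (c *s x) = c *s f x"
    for f :: "complex ^ 4 \<Rightarrow> complex ^ 4"
    using that by (simp add: Vector_Spaces.linear_iff vec.vector_space_axioms)
  then show ?thesis
    by (simp add: complex_algebra_def complex_algebra_axioms_def vec.vector_space_axioms
        table_mult_add table_mult_scale)
qed

lemma nat_1_30: "{1..30::nat} =
    set [1,2,3,4,5,6,7,8,9,10,11,12,13,14,15,16,17,18,19,20,21,22,23,24,25,26,27,28,29,30]"
proof -
  have "[1..<31] = [1,2,3,4,5,6,7,8,9,10,11,12,13,14,15,16,17,18,19,20,21,22,23,24,25,26,27,28,29,30]"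
    by (simp add: upt_conv_Cons)
  moreover have "{1..30} = set [1..<31::nat]" by auto
  ultimately show ?thesis by (rule subst)
qed

lemma listed_comm_assoc:
  assumes "n \<in> {1..30}" shows "comm_assoc_algebra (*s) (listed_mult n)"
proof -
  have "listed_mult n (V4 a b c d) (V4 a' b' c' d') = listed_mult n (V4 a' b' c' d') (V4 a b c d)"
    for a b c d a' b' c' d'
    using assms unfolding nat_1_30 list.set insert_iff empty_iff
    by (elim disjE; hypsubst?; simp add: listed_mult_V4 algebra_simps del: One_nat_def)
  then have comm: "listed_mult n x y = listed_mult n y x" for x y
    by (cases x rule: V4_cases; cases y rule: V4_cases; hypsubst)
  have "listed_mult n (listed_mult n (V4 a b c d) (V4 a' b' c' d')) (V4 a'' b'' c'' d'')
      = listed_mult n (V4 a b c d) (listed_mult n (V4 a' b' c' d') (V4 a'' b'' c'' d''))"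
    for a b c d a' b' c' d' a'' b'' c'' d''
    using assms unfolding nat_1_30 list.set insert_iff empty_iff
    by (elim disjE; hypsubst?; simp add: listed_mult_V4 algebra_simps del: One_nat_def)
  then have assoc: "listed_mult n (listed_mult n x y) z = listed_mult n x (listed_mult n y z)" for x y z
    by (cases x rule: V4_cases; cases y rule: V4_cases; cases z rule: V4_cases; hypsubst)
  show ?thesis
    using comm assoc table_mult_complex_algebra
    by (simp add: comm_assoc_algebra_def comm_assoc_algebra_axioms_def listed_mult_def)
qed

section \<open>Idempotents and the splitting off of a local summand\<close>

locale findim_comm_algebra =
  comm_assoc_algebra scale mul + finite_dimensional_vector_space scale Basis
  for scale :: "complex \<Rightarrow> 'a::ab_group_add \<Rightarrow> 'a" and mul :: "'a \<Rightarrow> 'a \<Rightarrow> 'a" and Basis :: "'a set"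
begin

notation scale (infixr "\<cdot>" 75)
notation mul (infixl "\<odot>" 70)

lemma mul_add: "(x + y) \<odot> z = x \<odot> z + y \<odot> z" "z \<odot> (x + y) = z \<odot> x + z \<odot> y"
  using linear_left linear_right by (simp_all add: Vector_Spaces.linear_iff)

lemma mul_scale: "(c \<cdot> x) \<odot> z = c \<cdot> (x \<odot> z)" "z \<odot> (c \<cdot> x) = c \<cdot> (z \<odot> x)"
  using linear_left linear_right by (simp_all add: Vector_Spaces.linear_iff)

lemma mul_zero [simp]: "0 \<odot> z = 0" "z \<odot> 0 = 0"
  using mul_scale(1)[of 0 0 z] mul_scale(2)[of z 0 0] by simp_all

lemma mul_minus: "(- x) \<odot> z = - (x \<odot> z)" "z \<odot> (- x) = - (z \<odot> x)"
  using mul_scale(1)[of "-1" x z] mul_scale(2)[of z "-1" x] by simp_all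

lemma mul_diff: "(x - y) \<odot> z = x \<odot> z - y \<odot> z" "z \<odot> (x - y) = z \<odot> x - z \<odot> y"
  by (simp_all add: mul_add mul_minus diff_conv_add_uminus del: add_uminus_conv_diff)

lemma left_comm: "x \<odot> (y \<odot> z) = y \<odot> (x \<odot> z)"
  by (metis assoc comm)

lemmas mul_ac = assoc comm left_comm
lemmas mul_distribs = mul_add mul_scale mul_minus mul_diff

lemma pow_mul: "(mul x ^^ n) (y \<odot> z) = (mul x ^^ n) y \<odot> z"
  by (induction n) (simp_all add: assoc)

lemma pow_mul_right: "(mul x ^^ n) (y \<odot> z) = y \<odot> (mul x ^^ n) z"
  by (metis comm pow_mul)

lemma pow_Suc: "(mul x ^^ Suc n) y = (mul x ^^ n) (x \<odot> y)"
  by (simp add: funpow_swap1)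

lemma pow_linear: "Vector_Spaces.linear scale scale (mul x ^^ n)"
proof (induction n)
  case 0
  then show ?case by (simp add: id_def linear_ident)
next
  case (Suc n)
  then show ?case
    by (simp add: Vector_Spaces.linear_iff mul_add mul_scale)
qed

lemma pow_add: "(mul x ^^ n) (y + z) = (mul x ^^ n) y + (mul x ^^ n) z"
  using pow_linear by (simp add: Vector_Spaces.linear_iff)

lemma pow_zero [simp]: "(mul x ^^ n) 0 = 0"
  by (induction n) simp_all

definition subalgebra :: "'a set \<Rightarrow> bool" where
  "subalgebra V \<longleftrightarrow> subspace V \<and> (\<forall>x\<in>V. \<forall>y\<in>V. x \<odot> y \<in> V)"

definition nilpotent :: "'a \<Rightarrow> bool" where
  "nilpotent x \<longleftrightarrow> (\<exists>n. (mul x ^^ n) x = 0)"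

lemma subalgebraD:
  assumes "subalgebra V"
  shows "subspace V" "x \<in> V \<Longrightarrow> y \<in> V \<Longrightarrow> x \<odot> y \<in> V" "x \<in> V \<Longrightarrow> y \<in> V \<Longrightarrow> (mul x ^^ n) y \<in> V"
proof -
  show *: "subspace V" "x \<in> V \<Longrightarrow> y \<in> V \<Longrightarrow> x \<odot> y \<in> V" for x y
    using assms by (auto simp: subalgebra_def)
  show "x \<in> V \<Longrightarrow> y \<in> V \<Longrightarrow> (mul x ^^ n) y \<in> V"
    by (induction n) (simp_all add: *)
qed

lemma subspace_image_pow: "subspace V \<Longrightarrow> subspace ((mul x ^^ n) ` V)"
  using module_hom.subspace_image[OF pow_linear[unfolded linear_iff_module_hom]] by blast

lemma subspace_image_mul: "subspace V \<Longrightarrow> subspace (mul x ` V)"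
  using subspace_image_pow[where n = 1] by simp

text \<open>The subspaces \<open>x\<^sup>k V\<close> decrease, so they become stationary at some \<open>k\<close>. Multiplication by
\<open>y = x\<^sup>k\<^sup>+\<^sup>1\<close> then maps \<open>x\<^sup>k V\<close> onto itself. As \<open>y\<close> lies in that subspace, \<open>y = ye\<close> and \<open>e = yw\<close> for some \<open>e\<close>
in it, and \<open>ee = (yw)e = (ye)w = e\<close>.\<close>

lemma idempotent_multiple:
  assumes V: "subalgebra V" and x: "x \<in> V" and not_nil: "\<not> nilpotent x"
  obtains e w where "e \<in> V" "w \<in> V" "e \<noteq> 0" "e \<odot> e = e" "e = x \<odot> w"
proof -
  note sub = subalgebraD[OF V]
  define W where "W k = (mul x ^^ k) ` V" for k
  have subW: "subspace (W k)" for k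
    unfolding W_def by (rule subspace_image_pow[OF sub(1)])
  have step: "W (Suc k) \<subseteq> W k" for k
    using x sub(2) unfolding W_def by (auto simp only: pow_Suc)
  have mono: "W (k + m) \<subseteq> W k" for k m
    by (induction m) (use step in auto)
  obtain k where k: "dim (W k) \<le> dim (W j)" for j
    using ex_has_least_nat[of "\<lambda>_. True" 0 "\<lambda>k. dim (W k)"] by auto
  have stable: "W (k + m) = W k" for m
    using subspace_dim_equal[OF subW subW mono k] by simp
  define y where "y = (mul x ^^ k) x"
  have yW: "y \<in> W k" unfolding y_def W_def using x by blast
  have "y \<noteq> 0" unfolding y_def using not_nil by (auto simp: nilpotent_def)
  have divide: "\<exists>v \<in> V. z = y \<odot> (mul x ^^ k) v" if "z \<in> W k" for z
  proof -
    from that have "z \<in> W (k + Suc k)" by (simp only: stable)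
    then obtain v where v: "v \<in> V" "z = (mul x ^^ (k + Suc k)) v" unfolding W_def by blast
    have "z = (mul x ^^ k) (x \<odot> (mul x ^^ k) v)" by (simp add: v funpow_add pow_mul_right)
    also have "\<dots> = y \<odot> (mul x ^^ k) v" by (simp only: pow_mul y_def)
    finally show ?thesis using v(1) by blast
  qed
  obtain v where v: "v \<in> V" "y = y \<odot> (mul x ^^ k) v" using divide[OF yW] by blast
  define e where "e = (mul x ^^ k) v"
  have eW: "e \<in> W k" unfolding e_def W_def using v by blast
  obtain v' where v': "v' \<in> V" "e = y \<odot> (mul x ^^ k) v'" using divide[OF eW] by blast
  define w where "w = (mul x ^^ k) v'"
  have ye: "y \<odot> e = y" and e: "e = y \<odot> w" using v v' by (simp_all add: e_def w_def)
  have "e \<odot> e = e" by (metis assoc comm ye e)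
  moreover have "e \<noteq> 0" using ye \<open>y \<noteq> 0\<close> by auto
  moreover have "e \<in> V" unfolding e_def using sub(3) x v(1) by blast
  moreover have "e = x \<odot> (mul x ^^ k) w"
    by (simp only: e y_def) (metis comm pow_mul)
  moreover have "(mul x ^^ k) w \<in> V" unfolding w_def using sub(3) x v'(1) by blast
  ultimately show thesis using that by blast
qed

text \<open>The idempotent is chosen so that \<open>eV\<close> has least dimension. A nonzero idempotent \<open>f\<close> with \<open>ef = f\<close> has
\<open>fV \<subseteq> eV\<close>, hence \<open>fV = eV\<close>, and then \<open>f\<close> fixes \<open>e\<close>.\<close>

lemma primitive_idempotent:
  assumes V: "subalgebra V" and x: "x \<in> V" and not_nil: "\<not> nilpotent x"
  obtains e where "e \<in> V" "e \<noteq> 0" "e \<odot> e = e"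
    "\<And>f. f \<in> V \<Longrightarrow> f \<noteq> 0 \<Longrightarrow> f \<odot> f = f \<Longrightarrow> e \<odot> f = f \<Longrightarrow> f = e"
proof -
  note sub = subalgebraD[OF V]
  define idem where "idem e \<longleftrightarrow> e \<in> V \<and> e \<noteq> 0 \<and> e \<odot> e = e" for e
  obtain e0 where "idem e0"
    using idempotent_multiple[OF assms] unfolding idem_def by metis
  then obtain e where e: "idem e" "\<And>f. idem f \<Longrightarrow> dim (mul e ` V) \<le> dim (mul f ` V)"
    using ex_has_least_nat[of idem e0 "\<lambda>e. dim (mul e ` V)"] by auto
  have "f = e" if f: "f \<in> V" "f \<noteq> 0" "f \<odot> f = f" "e \<odot> f = f" for f
  proof -
    have "mul f ` V \<subseteq> mul e ` V"
      using f sub(2) by (auto simp: image_iff) (metis assoc)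
    with f e have "mul f ` V = mul e ` V"
      by (intro subspace_dim_equal subspace_image_mul sub(1)) (auto simp: idem_def)
    moreover have "e \<in> mul e ` V" using e(1) by (auto simp: idem_def image_iff) metis
    ultimately obtain v where "e = f \<odot> v" by blast
    then show "f = e" using f by (metis assoc comm)
  qed
  then show thesis using that e(1) unfolding idem_def by blast
qed

text \<open>This yields a nontrivial linear relation between the iterates of an operator.\<close>

lemma in_span_of_previous:
  fixes u :: "nat \<Rightarrow> 'a"
  shows "\<exists>n. u n \<in> span (u ` {..<n})"
proof (rule ccontr)
  assume "\<not> ?thesis"
  then have new: "u n \<notin> span (u ` {..<n})" for n by blast
  have "independent (u ` {..<n}) \<and> card (u ` {..<n}) = n" for n
  proof (induction n)
    case (Suc n)
    have "u n \<notin> u ` {..<n}"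
      using new[of n] span_base[of "u n" "u ` {..<n}"] by (rule contrapos_nn)
    with Suc new[of n] show ?case
      by (simp add: lessThan_Suc independent_insert)
  qed (simp add: independent_empty)
  from this[of "Suc (dim UNIV)"] show False
    using independent_card_le_dim[OF subset_UNIV, of "u ` {..<Suc (dim UNIV)}"] by simp
qed

text \<open>The evaluation \<open>p \<mapsto> p(g) v0\<close> vanishes on some nonzero polynomial. If \<open>p\<close> has least degree among these
and \<open>z\<close> is a root of \<open>p = (X - z) q\<close>, then \<open>q(g) v0\<close> is an eigenvector for \<open>z\<close>.\<close>

lemma eigenvector:
  assumes g: "Vector_Spaces.linear scale scale g" and B: "subspace B" "\<And>v. v \<in> B \<Longrightarrow> g v \<in> B"
    and v0: "v0 \<in> B" "v0 \<noteq> 0"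
  obtains c v where "v \<in> B" "v \<noteq> 0" "g v = c \<cdot> v"
proof -
  have g_add: "g (x + y) = g x + g y" and g_scale: "g (c \<cdot> x) = c \<cdot> g x" for x y c
    using g by (simp_all add: Vector_Spaces.linear_iff)
  have g_0: "g 0 = 0" using g_scale[of 0 0] by simp
  define ev where "ev p = fold_coeffs (\<lambda>a z. a \<cdot> v0 + g z) p 0" for p
  have ev_0 [simp]: "ev 0 = 0" by (simp add: ev_def)
  have ev_pCons [simp]: "ev (pCons a p) = a \<cdot> v0 + g (ev p)" for a p
    by (cases "p = 0"; cases "a = 0") (simp_all add: ev_def g_0)
  have ev_add: "ev (p + q) = ev p + ev q" for p q
    by (induction p q rule: poly_induct2) (simp_all add: g_add scale_left_distrib add_ac)
  have ev_smult: "ev (smult c p) = c \<cdot> ev p" for c p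
    by (induction p) (simp_all add: g_scale scale_right_distrib)
  have evB: "ev p \<in> B" for p
    by (induction p) (simp_all add: B v0 subspace_add subspace_scale subspace_0)
  have "\<exists>p. p \<noteq> 0 \<and> ev p = 0"
  proof -
    define u where "u i = ev (monom 1 i)" for i
    obtain n where n: "u n \<in> span (u ` {..<n})" using in_span_of_previous by blast
    let ?S = "{ev q |q. \<forall>i\<ge>n. coeff q i = 0}"
    have "subspace ?S"
    proof (rule subspaceI)
      show "0 \<in> ?S" by (intro CollectI exI[of _ 0]) simp
      show "x + y \<in> ?S" if "x \<in> ?S" "y \<in> ?S" for x y
      proof -
        obtain p q where "x = ev p" "y = ev q" "\<forall>i\<ge>n. coeff p i = 0" "\<forall>i\<ge>n. coeff q i = 0"
          using \<open>x \<in> ?S\<close> \<open>y \<in> ?S\<close> by blast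
        then have "x + y = ev (p + q) \<and> (\<forall>i\<ge>n. coeff (p + q) i = 0)" by (simp add: ev_add)
        then show ?thesis by blast
      qed
      show "c \<cdot> x \<in> ?S" if "x \<in> ?S" for c x
      proof -
        obtain p where "x = ev p" "\<forall>i\<ge>n. coeff p i = 0" using \<open>x \<in> ?S\<close> by blast
        then have "c \<cdot> x = ev (smult c p) \<and> (\<forall>i\<ge>n. coeff (smult c p) i = 0)" by (simp add: ev_smult)
        then show ?thesis by blast
      qed
    qed
    moreover have "u ` {..<n} \<subseteq> ?S"
    proof
      fix x assume "x \<in> u ` {..<n}"
      then obtain i where "i < n" "x = ev (monom 1 i)" by (auto simp: u_def)
      then show "x \<in> ?S" by (auto intro!: exI[of _ "monom 1 i"])
    qed
    ultimately have "u n \<in> ?S" using n span_minimal by blast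
    then obtain q where q: "u n = ev q" "\<forall>i\<ge>n. coeff q i = 0" by blast
    define p where "p = monom 1 n + smult (-1) q"
    have "ev p = 0"
      unfolding p_def ev_add ev_smult using q(1) by (simp add: u_def)
    moreover have "coeff p n = 1" using q(2) by (simp add: p_def)
    ultimately show ?thesis by (metis coeff_0 zero_neq_one)
  qed
  then obtain p where p: "p \<noteq> 0" "ev p = 0" and least: "\<And>q. q \<noteq> 0 \<Longrightarrow> ev q = 0 \<Longrightarrow> degree p \<le> degree q"
    using ex_has_least_nat[of "\<lambda>p. p \<noteq> 0 \<and> ev p = 0" _ degree] by metis
  have "\<exists>z. poly p z = 0"
  proof (rule fundamental_theorem_of_algebra_alt, rule notI)
    assume "\<exists>a l. a \<noteq> 0 \<and> l = 0 \<and> p = pCons a l"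
    then obtain a where "a \<noteq> 0" "p = [:a:]" by blast
    with p(2) v0(2) show False by (simp add: g_0)
  qed
  then obtain z q where q: "p = [:- z, 1:] * q" by (auto simp: poly_eq_0_iff_dvd)
  then have "q \<noteq> 0" using p(1) by auto
  then have "degree p = degree [:- z, 1:] + degree q" unfolding q by (intro degree_mult_eq) simp_all
  then have "degree q < degree p" by simp
  then have "ev q \<noteq> 0" using least[OF \<open>q \<noteq> 0\<close>] by auto
  moreover have "g (ev q) = z \<cdot> ev q"
  proof -
    have "p = smult (- z) q + pCons 0 q" by (simp add: q)
    then have "ev p = - (z \<cdot> ev q) + g (ev q)" by (simp only: ev_add ev_smult ev_pCons) simp
    with p(2) show ?thesis by simp
  qed
  ultimately show thesis using that evB by blast
qed

text \<open>Subtracting an eigenvalue \<open>c\<close> of multiplication by \<open>x\<close> on \<open>eV\<close> leaves an element that kills a nonzero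
vector of \<open>eV\<close>. Were it not nilpotent, it would have an idempotent multiple, which could only be
\<open>e\<close>, and \<open>e\<close> kills no nonzero vector of \<open>eV\<close>.\<close>

lemma scalar_plus_nilpotent:
  assumes V: "subalgebra V" and e: "e \<in> V" "e \<noteq> 0" "e \<odot> e = e"
    and prim: "\<And>f. f \<in> V \<Longrightarrow> f \<noteq> 0 \<Longrightarrow> f \<odot> f = f \<Longrightarrow> e \<odot> f = f \<Longrightarrow> f = e"
    and x: "x \<in> V" "e \<odot> x = x"
  obtains c where "nilpotent (x - c \<cdot> e)"
proof -
  note sub = subalgebraD[OF V]
  have "e \<in> mul e ` V" using e by (auto simp: image_iff) metis
  moreover have "x \<odot> v \<in> mul e ` V" if "v \<in> mul e ` V" for v
    using that sub(2) x(1) by (auto simp: image_iff) (metis left_comm)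
  ultimately obtain c v where v: "v \<in> mul e ` V" "v \<noteq> 0" "x \<odot> v = c \<cdot> v"
    using eigenvector[OF linear_right subspace_image_mul[OF sub(1)] _ _ e(2)] by metis
  let ?u = "x - c \<cdot> e"
  have ev: "e \<odot> v = v" using v(1) e(3) by (auto simp flip: assoc)
  have uv: "?u \<odot> v = 0" using v(3) by (simp add: mul_distribs ev)
  have uV: "?u \<in> V" using x(1) e(1) sub(1) by (simp add: subspace_diff subspace_scale)
  have eu: "e \<odot> ?u = ?u" using x(2) e(3) by (simp add: mul_distribs)
  have "nilpotent ?u"
  proof (rule ccontr)
    assume "\<not> nilpotent ?u"
    then obtain f w where f: "f \<in> V" "f \<noteq> 0" "f \<odot> f = f" "f = ?u \<odot> w"
      using idempotent_multiple[OF V uV] by metis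
    have "e \<odot> f = f" by (metis f(4) eu assoc)
    then have "f = e" using prim f by blast
    then have "v = w \<odot> (?u \<odot> v)" by (metis ev f(4) mul_ac)
    then show False using uv v(2) by simp
  qed
  then show thesis by (rule that)
qed

lemma nilpotent_kills:
  assumes "nilpotent x" shows "\<exists>n. \<forall>z. (mul x ^^ n) z = 0"
proof -
  obtain n where "(mul x ^^ n) x = 0" using assms unfolding nilpotent_def by blast
  then have "(mul x ^^ Suc n) z = 0" for z
    by (simp only: pow_Suc pow_mul mul_zero)
  then show ?thesis by blast
qed

lemma nilpotentI: "\<forall>z. (mul x ^^ n) z = 0 \<Longrightarrow> nilpotent x"
  unfolding nilpotent_def by blast

text \<open>This replaces the binomial theorem for two commuting operators: peel one factor \<open>x + y\<close> and use the
induction hypothesis for \<open>xz\<close> and for \<open>yz\<close>.\<close>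

lemma pow_sum_zero:
  "(mul x ^^ m) z = 0 \<Longrightarrow> (mul y ^^ n) z = 0 \<Longrightarrow> (mul (x + y) ^^ (m + n)) z = 0"
proof (induction "m + n" arbitrary: m n z)
  case (Suc k)
  show ?case
  proof (cases "m = 0 \<or> n = 0")
    case True
    with Suc.prems have "z = 0" by auto
    then show ?thesis by simp
  next
    case False
    then obtain m' n' where mn: "m = Suc m'" "n = Suc n'" by (metis not0_implies_Suc)
    have "(mul (x + y) ^^ (m' + n)) (x \<odot> z) = 0"
      using Suc.prems Suc.hyps(2) mn(1) by (intro Suc.hyps) (simp_all add: pow_mul_right flip: pow_Suc)
    moreover have "(mul (x + y) ^^ (m + n')) (y \<odot> z) = 0"
      using Suc.prems Suc.hyps(2) mn(2) by (intro Suc.hyps) (simp_all add: pow_mul_right flip: pow_Suc)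
    moreover have "m + n = Suc (m' + n)" "m + n' = m' + n" using mn by simp_all
    ultimately show ?thesis by (simp add: pow_Suc pow_add mul_add del: funpow.simps)
  qed
qed simp

lemma nilpotent_add:
  assumes "nilpotent x" "nilpotent y" shows "nilpotent (x + y)"
proof -
  obtain m n where "\<forall>z. (mul x ^^ m) z = 0" "\<forall>z. (mul y ^^ n) z = 0"
    using nilpotent_kills[OF assms(1)] nilpotent_kills[OF assms(2)] by blast
  then show ?thesis by (intro nilpotentI[where n = "m + n"]) (simp add: pow_sum_zero)
qed

lemma nilpotent_mul:
  assumes "nilpotent x" shows "nilpotent (x \<odot> y)"
proof -
  obtain n where n: "\<forall>z. (mul x ^^ n) z = 0" using nilpotent_kills[OF assms] by blast
  have "(mul (x \<odot> y) ^^ k) z = (mul x ^^ k) ((mul y ^^ k) z)" for k z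
    by (induction k arbitrary: z) (simp_all add: assoc pow_mul_right)
  with n show ?thesis by (intro nilpotentI[where n = n]) simp
qed

lemma nilpotent_zero: "nilpotent 0"
  unfolding nilpotent_def by (intro exI[of _ 0]) simp

lemma nilpotent_scale:
  assumes "nilpotent x" shows "nilpotent (c \<cdot> x)"
proof -
  obtain n where n: "(mul x ^^ n) x = 0" using assms unfolding nilpotent_def by blast
  have "(mul (c \<cdot> x) ^^ k) z = c ^ k \<cdot> (mul x ^^ k) z" for k z
    by (induction k) (simp_all add: mul_scale)
  with n show ?thesis unfolding nilpotent_def
    by (intro exI[of _ n]) (simp add: module_hom.scale[OF pow_linear[unfolded linear_iff_module_hom]])
qed

lemma nilpotent_eigenvalue:
  assumes "nilpotent x" "x \<odot> v = c \<cdot> v" "v \<noteq> 0" shows "c = 0"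
proof -
  obtain n where n: "\<forall>z. (mul x ^^ n) z = 0" using nilpotent_kills[OF assms(1)] by blast
  have "(mul x ^^ k) v = c ^ k \<cdot> v" for k
    by (induction k) (simp_all add: mul_scale assms(2) mult.commute)
  with n have "c ^ n \<cdot> v = 0" by metis
  with assms(3) show ?thesis by simp
qed

end

section \<open>Bases with monomial multiplication tables\<close>

type_synonym monomial_table = "nat \<Rightarrow> nat \<Rightarrow> nat option"

fun entry :: "(nat \<times> nat \<times> nat) list \<Rightarrow> monomial_table" where
  "entry [] i j = None"
| "entry ((a, b, c) # T) i j = (if i = a \<and> j = b \<or> i = b \<and> j = a then Some c else entry T i j)"

text \<open>The table of the basis \<open>e, m\<^sub>1, \<dots>, m\<^sub>k, w\<^sub>1, \<dots>, w\<^sub>l\<close> of \<open>\<complex>e \<oplus> M \<oplus> W\<close>, where \<open>e\<close> acts as identity on \<open>M\<close>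
(so \<open>k\<close> is the first argument) and as zero on \<open>W\<close>; \<open>S\<close> and \<open>T\<close> are the tables of \<open>M\<close> and \<open>W\<close>.\<close>

definition split_table :: "nat \<Rightarrow> monomial_table \<Rightarrow> monomial_table \<Rightarrow> monomial_table" where
  "split_table m S T i j =
     (if i = 0 then if j \<le> m then Some j else None
      else if j = 0 then if i \<le> m then Some i else None
      else if i \<le> m \<and> j \<le> m then map_option Suc (S (i - 1) (j - 1))
      else if m < i \<and> m < j then map_option (\<lambda>k. k + Suc m) (T (i - Suc m) (j - Suc m))
      else None)"

context findim_comm_algebra begin

text \<open>Bases are lists because the tables refer to their positions.\<close>

primrec indep_list :: "'a list \<Rightarrow> bool" where
  "indep_list [] \<longleftrightarrow> True"
| "indep_list (v # vs) \<longleftrightarrow> v \<notin> span (set vs) \<and> indep_list vs"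

lemma indep_list_iff: "indep_list vs \<longleftrightarrow> distinct vs \<and> independent (set vs)"
proof (induction vs)
  case (Cons v vs)
  have "v \<notin> set vs" if "v \<notin> span (set vs)" using that span_base[of v "set vs"] by blast
  with Cons show ?case by (auto simp: independent_insert)
qed (simp add: independent_empty)

lemma indep_list_cong:
  "indep_list vs \<Longrightarrow> set ws = set vs \<Longrightarrow> length ws = length vs \<Longrightarrow> indep_list ws"
  by (simp add: indep_list_iff card_distinct distinct_card)

lemma indep_list_length_le: "indep_list vs \<Longrightarrow> set vs \<subseteq> V \<Longrightarrow> length vs \<le> dim V"
  using independent_card_le_dim[of "set vs" V] by (simp add: indep_list_iff distinct_card)

lemma indep_list_dim: "indep_list vs \<Longrightarrow> dim (span (set vs)) = length vs"
  by (simp add: indep_list_iff dim_eq_card_independent distinct_card)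

lemma indep_list_spans:
  assumes "indep_list vs" "set vs \<subseteq> V" "subspace V" "dim V = length vs"
  shows "span (set vs) = V"
proof -
  have "V \<subseteq> span (set vs)"
    using assms by (intro card_ge_dim_independent) (auto simp: indep_list_iff distinct_card)
  then show ?thesis using span_minimal[OF assms(2,3)] by blast
qed

lemma spanning_indep_list:
  assumes "set vs \<subseteq> V" "V \<subseteq> span (set vs)" "dim V = length vs"
  shows "indep_list vs"
proof -
  have "dim V \<le> card (set vs)" using dim_le_card[OF assms(2)] by simp
  then have "card (set vs) = length vs" using card_length[of vs] assms(3) by simp
  then have "distinct vs" by (rule card_distinct)
  moreover have "independent (set vs)"
    using assms(3) \<open>card (set vs) = length vs\<close> by (intro card_le_dim_spanning[OF assms(1,2)]) simp_all
  ultimately show ?thesis by (simp add: indep_list_iff)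
qed

lemma exists_outside_span:
  assumes "length vs < dim V" obtains y where "y \<in> V" "y \<notin> span (set vs)"
proof -
  have "\<not> V \<subseteq> span (set vs)"
    using dim_le_card[of V "set vs"] card_length[of vs] assms by force
  then show thesis using that by blast
qed

lemma exists_basis_list:
  assumes "subspace V" obtains vs where "indep_list vs" "span (set vs) = V" "length vs = dim V"
proof -
  obtain B where B: "B \<subseteq> V" "independent B" "V \<subseteq> span B" "card B = dim V"
    using basis_exists by blast
  obtain vs where vs: "set vs = B" "distinct vs"
    using finite_distinct_list[OF finiteI_independent[OF B(2)]] by blast
  have "span (set vs) = V" using B span_minimal[OF B(1) assms] vs by auto
  moreover have "length vs = dim V" using vs B(4) by (metis distinct_card)
  ultimately show thesis using B(2) vs by (intro that[of vs]) (simp_all add: indep_list_iff)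
qed

lemma indep_list_append:
  assumes "indep_list vs" "indep_list ws" "span (set vs) \<inter> span (set ws) \<subseteq> {0}"
  shows "indep_list (vs @ ws)"
  using assms(1,3)
proof (induction vs)
  case (Cons v vs)
  have sub: "span (set vs) \<subseteq> span (set (v # vs))" by (intro span_mono) auto
  have "v \<notin> span (set vs \<union> set ws)"
  proof
    assume "v \<in> span (set vs \<union> set ws)"
    then obtain a b where ab: "v = a + b" "a \<in> span (set vs)" "b \<in> span (set ws)"
      by (auto simp: span_Un)
    then have "b = v - a" by simp
    also have "\<dots> \<in> span (set (v # vs))"
      using ab(2) sub by (intro span_diff) (auto intro: span_base)
    finally have "b = 0" using ab(3) Cons.prems(2) by blast
    with ab Cons.prems(1) show False by simp
  qed
  moreover have "indep_list (vs @ ws)"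
    using Cons.prems sub by (intro Cons.IH) auto
  ultimately show ?case by simp
qed (use assms(2) in simp)

definition basis_value :: "'a list \<Rightarrow> nat option \<Rightarrow> 'a" where
  "basis_value vs r = (case r of None \<Rightarrow> 0 | Some k \<Rightarrow> vs ! k)"

lemma basis_value_simps [simp]: "basis_value vs None = 0" "basis_value vs (Some k) = vs ! k"
  by (simp_all add: basis_value_def)

text \<open>The last condition keeps the positions in range, so that \<open>nth\<close> is never applied outside the list and
the tables of two summands do not interfere after shifting.\<close>

definition presents :: "'a set \<Rightarrow> 'a list \<Rightarrow> monomial_table \<Rightarrow> bool" where
  "presents V vs T \<longleftrightarrow> indep_list vs \<and> span (set vs) = V \<and>
     (\<forall>i<length vs. \<forall>j<length vs. vs ! i \<odot> vs ! j = basis_value vs (T i j)) \<and>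
     (\<forall>i<length vs. \<forall>j<length vs. \<forall>k. T i j = Some k \<longrightarrow> k < length vs)"

lemma presents_dim: "presents V vs T \<Longrightarrow> length vs = dim V"
  using indep_list_dim[of vs] by (simp add: presents_def)

text \<open>A unital hull of \<open>M\<close> times \<open>W\<close> is presented by concatenating the bases; \<open>M W = 0\<close> follows from
\<open>mw = (em)w = m(ew)\<close>.\<close>

lemma presents_split:
  assumes S: "presents M ms S" and T: "presents W ws T"
    and e: "e \<in> V" "e \<odot> e = e" "e \<notin> M" 
    and M: "\<And>x. x \<in> M \<Longrightarrow> x \<in> V \<and> e \<odot> x = x" and W: "\<And>x. x \<in> W \<Longrightarrow> x \<in> V \<and> e \<odot> x = 0"
    and V: "subspace V" "\<And>v. v \<in> V \<Longrightarrow> \<exists>c m w. m \<in> M \<and> w \<in> W \<and> v = c \<cdot> e + m + w"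
  shows "presents V (e # ms @ ws) (split_table (length ms) S T)"
proof -
  have ms: "indep_list ms" "span (set ms) = M" and ws: "indep_list ws" "span (set ws) = W"
    using S T by (auto simp: presents_def)
  have msM: "ms ! i \<in> M" if "i < length ms" for i using that ms(2) span_base nth_mem by blast
  have wsW: "ws ! i \<in> W" if "i < length ws" for i using that ws(2) span_base nth_mem by blast
  have "M \<inter> W \<subseteq> {0}" using M W by fastforce
  then have "indep_list (ms @ ws)" using ms ws by (intro indep_list_append) simp_all
  moreover have sp: "span (set ms \<union> set ws) = {x + y |x y. x \<in> M \<and> y \<in> W}"
    by (simp add: span_Un ms ws)
  have "e \<notin> span (set ms \<union> set ws)"
  proof
    assume "e \<in> span (set ms \<union> set ws)"
    then obtain m w where "e = m + w" "m \<in> M" "w \<in> W" unfolding sp by blast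
    then have "e \<odot> e = m" using M W by (simp add: mul_add)
    with e(2) have "m = e" by simp
    with e(3) \<open>m \<in> M\<close> show False by simp
  qed
  ultimately have indep: "indep_list (e # ms @ ws)" by simp
  have "set (e # ms @ ws) \<subseteq> V"
    using e(1) M W ms(2) ws(2) span_superset[of "set ms"] span_superset[of "set ws"] by auto
  then have "span (set (e # ms @ ws)) \<subseteq> V" using V(1) by (rule span_minimal)
  moreover have "V \<subseteq> span (set (e # ms @ ws))"
  proof
    fix v assume "v \<in> V"
    then obtain c m w where v: "m \<in> M" "w \<in> W" "v = c \<cdot> e + m + w" using V(2) by blast
    then have "v - c \<cdot> e \<in> span (set ms \<union> set ws)" unfolding sp by auto
    then show "v \<in> span (set (e # ms @ ws))" by (auto simp: span_breakdown_eq)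
  qed
  ultimately have span: "span (set (e # ms @ ws)) = V" by blast
  have prodS: "ms ! i \<odot> ms ! j = basis_value ms (S i j)" if "i < length ms" "j < length ms" for i j
    using S that unfolding presents_def by blast
  have prodT: "ws ! i \<odot> ws ! j = basis_value ws (T i j)" if "i < length ws" "j < length ws" for i j
    using T that unfolding presents_def by blast
  have rS: "k < length ms" if "i < length ms" "j < length ms" "S i j = Some k" for i j k
    using S that unfolding presents_def by blast
  have rT: "k < length ws" if "i < length ws" "j < length ws" "T i j = Some k" for i j k
    using T that unfolding presents_def by blast
  have val_M: "basis_value (e # ms @ ws) (map_option Suc (S i j)) = ms ! i \<odot> ms ! j"
    if "i < length ms" "j < length ms" for i j
    unfolding prodS[OF that] using rS[OF that] by (cases "S i j") (simp_all add: nth_append)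
  have val_W: "basis_value (e # ms @ ws) (map_option (\<lambda>k. k + Suc (length ms)) (T i j)) = ws ! i \<odot> ws ! j"
    if "i < length ws" "j < length ws" for i j
    unfolding prodT[OF that] using rT[OF that] by (cases "T i j") (simp_all add: nth_append)
  have pos: "i = 0 \<or> (\<exists>k<length ms. i = Suc k) \<or> (\<exists>k<length ws. i = Suc (length ms) + k)"
    if "i < Suc (length ms + length ws)" for i
  proof (cases "i \<le> length ms")
    case True
    then show ?thesis by (cases i) auto
  next
    case False
    with that have "i - Suc (length ms) < length ws" "i = Suc (length ms) + (i - Suc (length ms))"
      by auto
    then show ?thesis by blast
  qed
  have MW: "ms ! i \<odot> ws ! j = 0" if "i < length ms" "j < length ws" for i j
  proof -
    have "ms ! i \<odot> ws ! j = (e \<odot> ms ! i) \<odot> ws ! j" using M msM that by simp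
    also have "\<dots> = ms ! i \<odot> (e \<odot> ws ! j)" by (simp only: mul_ac)
    also have "\<dots> = 0" using W wsW that by simp
    finally show ?thesis .
  qed
  have eM: "e \<odot> ms ! i = ms ! i" "ms ! i \<odot> e = ms ! i" if "i < length ms" for i
    using M msM[OF that] comm by metis+
  have eW: "e \<odot> ws ! i = 0" "ws ! i \<odot> e = 0" if "i < length ws" for i
    using W wsW[OF that] comm by metis+
  have WM: "ws ! j \<odot> ms ! i = 0" if "i < length ms" "j < length ws" for i j
    using MW[OF that] by (metis comm)
  let ?vs = "e # ms @ ws" and ?T = "split_table (length ms) S T"
  have M1: "?vs ! Suc k = ms ! k" if "k < length ms" for k using that by (simp add: nth_append)
  have W1: "?vs ! (Suc (length ms) + k) = ws ! k" for k by (simp add: nth_append)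
  have T0: "?T 0 0 = Some 0" by (simp add: split_table_def)
  have TM: "?T 0 (Suc k) = Some (Suc k)" "?T (Suc k) 0 = Some (Suc k)" if "k < length ms" for k
    using that by (simp_all add: split_table_def)
  have TW: "?T 0 (Suc (length ms) + k) = None" "?T (Suc (length ms) + k) 0 = None" for k
    by (simp_all add: split_table_def)
  have TMM: "?T (Suc k) (Suc l) = map_option Suc (S k l)" if "k < length ms" "l < length ms" for k l
    using that by (simp add: split_table_def)
  have TMW: "?T (Suc k) (Suc (length ms) + l) = None" "?T (Suc (length ms) + l) (Suc k) = None"
    if "k < length ms" for k l
    using that by (simp_all add: split_table_def)
  have TWW: "?T (Suc (length ms) + k) (Suc (length ms) + l) = map_option (\<lambda>k. k + Suc (length ms)) (T k l)"
    for k l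
    by (simp add: split_table_def)
  have "(e # ms @ ws) ! i \<odot> (e # ms @ ws) ! j = basis_value (e # ms @ ws) (split_table (length ms) S T i j)"
    if "i < Suc (length ms + length ws)" "j < Suc (length ms + length ws)" for i j
    using pos[OF that(1)] pos[OF that(2)]
    by (elim disjE exE conjE; hypsubst;
          simp only: M1 W1 T0 TM TW TMM TMW TWW val_M val_W basis_value_simps e(2) eM eW MW WM nth_Cons_0)
  moreover have "k < Suc (length ms + length ws)"
    if ij: "i < Suc (length ms + length ws)" "j < Suc (length ms + length ws)" and k: "?T i j = Some k" for i j k
  proof -
    have SS: "k < Suc (length ms + length ws)"
      if "a < length ms" "b < length ms" "?T (Suc a) (Suc b) = Some k" for a b
      using that(3) rS[OF that(1,2)] unfolding TMM[OF that(1,2)] by (cases "S a b") auto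
    have TT: "k < Suc (length ms + length ws)"
      if "a < length ws" "b < length ws" "?T (Suc (length ms) + a) (Suc (length ms) + b) = Some k" for a b
      using that(3) rT[OF that(1,2)] unfolding TWW by (cases "T a b") auto
    from pos[OF ij(1)] show ?thesis
    proof (elim disjE exE conjE)
      assume i: "i = 0"
      from pos[OF ij(2)] show ?thesis
        using k unfolding i by (elim disjE exE conjE; hypsubst) (simp_all add: T0 TM TW del: add_Suc)
    next
      fix a assume a: "a < length ms" "i = Suc a"
      from pos[OF ij(2)] show ?thesis
        using k a(1) SS unfolding a(2)
        by (elim disjE exE conjE; hypsubst) (simp_all add: TM TMW del: add_Suc)
    next
      fix a assume a: "a < length ws" "i = Suc (length ms) + a"
      from pos[OF ij(2)] show ?thesis
        using k a(1) TT unfolding a(2)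
        by (elim disjE exE conjE; hypsubst) (simp_all add: TW TMW del: add_Suc)
    qed
  qed
  ultimately show ?thesis
    unfolding presents_def length_Cons length_append using indep span by blast
qed

lemma presentsI:
  assumes "subspace V" "indep_list vs" "set vs \<subseteq> V" "dim V = length vs"
    and "\<forall>i<length vs. \<forall>j<length vs. vs ! i \<odot> vs ! j = basis_value vs (entry T i j)"
    and "\<forall>(a, b, c) \<in> set T. c < length vs"
  shows "presents V vs (entry T)"
proof -
  have range: "\<exists>a b. (a, b, k) \<in> set T" if "entry T i j = Some k" for i j k
    using that by (induction T i j rule: entry.induct) (auto split: if_splits)
  have "\<forall>i j k. entry T i j = Some k \<longrightarrow> k < length vs"
    using assms(6) range by fast
  then show ?thesis
    unfolding presents_def using indep_list_spans[OF assms(2,3,1,4)] assms(2,5) by simp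
qed

text \<open>One step of the product decomposition: \<open>\<complex>e \<oplus> M\<close> is a local unital algebra with maximal ideal \<open>M\<close>.\<close>

lemma local_splitting:
  assumes V: "subalgebra V" and x: "x \<in> V" "\<not> nilpotent x"
  obtains e M W where "subalgebra M" "subalgebra W" "\<And>x. x \<in> M \<Longrightarrow> nilpotent x"
    "e \<in> V" "e \<odot> e = e" "e \<notin> M"
    "\<And>x. x \<in> M \<Longrightarrow> x \<in> V \<and> e \<odot> x = x" "\<And>x. x \<in> W \<Longrightarrow> x \<in> V \<and> e \<odot> x = 0"
    "\<And>v. v \<in> V \<Longrightarrow> \<exists>c m w. m \<in> M \<and> w \<in> W \<and> v = c \<cdot> e + m + w"
proof -
  note sub = subalgebraD[OF V]
  obtain e where e: "e \<in> V" "e \<noteq> 0" "e \<odot> e = e"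
    and prim: "\<And>f. f \<in> V \<Longrightarrow> f \<noteq> 0 \<Longrightarrow> f \<odot> f = f \<Longrightarrow> e \<odot> f = f \<Longrightarrow> f = e"
    using primitive_idempotent[OF V x] by metis
  define M where "M = {x \<in> V. e \<odot> x = x \<and> nilpotent x}"
  define W where "W = {x \<in> V. e \<odot> x = 0}"
  have 1: "subalgebra M"
    unfolding subalgebra_def M_def subspace_def
    using sub(2) subspace_0[OF sub(1)] subspace_add[OF sub(1)] subspace_scale[OF sub(1)]
    by (auto simp: nilpotent_zero nilpotent_add nilpotent_scale nilpotent_mul mul_add mul_scale
        simp flip: assoc)
  have 2: "subalgebra W"
    unfolding subalgebra_def W_def subspace_def
    using sub(2) subspace_0[OF sub(1)] subspace_add[OF sub(1)] subspace_scale[OF sub(1)]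
    by (auto simp: mul_add mul_scale simp flip: assoc)
  have 3: "e \<notin> M"
    using nilpotent_eigenvalue[of e e 1] e by (auto simp: M_def)
  have 4: "\<exists>c m w. m \<in> M \<and> w \<in> W \<and> v = c \<cdot> e + m + w" if v: "v \<in> V" for v
  proof -
    have ev: "e \<odot> v \<in> V" "e \<odot> (e \<odot> v) = e \<odot> v"
      using sub(2) e(1,3) v by (simp_all flip: assoc)
    obtain c where c: "nilpotent (e \<odot> v - c \<cdot> e)"
      using scalar_plus_nilpotent[OF V e prim ev] by blast
    have "e \<odot> v - c \<cdot> e \<in> M"
      using c ev e sub(1) by (simp add: M_def subspace_diff subspace_scale mul_distribs)
    moreover have "v - e \<odot> v \<in> W"
      using ev v sub(1) by (simp add: W_def subspace_diff mul_distribs)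
    moreover have "v = c \<cdot> e + (e \<odot> v - c \<cdot> e) + (v - e \<odot> v)" by simp
    ultimately show ?thesis by blast
  qed
  show thesis
    by (rule that[of M W e]) (use 1 2 3 4 e in \<open>simp_all add: M_def W_def\<close>)
qed

end

section \<open>Nilpotent algebras of dimension at most four\<close>

text \<open>One table for each isomorphism class of nilpotent algebras of dimension \<open>d \<le> 4\<close>. A single quadratic
form is in diagonal shape, and a pencil of rank two is given by the two squares of vectors with
product zero, since the proofs produce these shapes.\<close>

definition nil_tables :: "nat \<Rightarrow> (nat \<times> nat \<times> nat) list list" where
  "nil_tables d =
     (if d = 2 then [[], [(0,0,1)]]
      else if d = 3 then [[], [(0,0,1)], [(0,0,2), (1,1,2)], [(0,0,1), (0,1,2)]]
      else if d = 4 then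
        [[], [(0,0,1)], [(0,0,2), (1,1,2)], [(0,0,3), (1,1,3), (2,2,3)],
         [(0,0,1), (0,1,2)], [(0,0,1), (0,1,3), (2,2,3)], [(0,0,1), (0,1,2), (0,2,3), (1,1,3)],
         [(0,1,3), (1,1,2)], [(0,0,2), (1,1,3)]]
      else [[]])"

context findim_comm_algebra begin

definition nil_subalgebra :: "'a set \<Rightarrow> bool" where
  "nil_subalgebra N \<longleftrightarrow> subalgebra N \<and> (\<forall>x\<in>N. nilpotent x)"

definition nil_presented :: "'a set \<Rightarrow> bool" where
  "nil_presented N \<longleftrightarrow> (\<exists>vs. \<exists>T\<in>set (nil_tables (dim N)). presents N vs (entry T))"

lemma nil_subalgebraD:
  assumes "nil_subalgebra N"
  shows "subspace N" "x \<in> N \<Longrightarrow> y \<in> N \<Longrightarrow> x \<odot> y \<in> N" "x \<in> N \<Longrightarrow> nilpotent x"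
    "x \<in> N \<Longrightarrow> y \<in> N \<Longrightarrow> x + y \<in> N" "x \<in> N \<Longrightarrow> y \<in> N \<Longrightarrow> x - y \<in> N" "x \<in> N \<Longrightarrow> c \<cdot> x \<in> N"
  using assms by (simp_all add: nil_subalgebra_def subalgebra_def subspace_add subspace_diff subspace_scale)

lemma pow_eq_zero_mono: "(mul x ^^ m) y = 0 \<Longrightarrow> m \<le> n \<Longrightarrow> (mul x ^^ n) y = 0"
  by (induction n) (auto simp: le_Suc_eq)

lemma indep_list_prefix: "indep_list (vs @ ws) \<Longrightarrow> indep_list vs"
  using independent_mono[of "set vs \<union> set ws" "set vs"] by (simp add: indep_list_iff)

text \<open>Applying the right power of \<open>x\<close> to a vector \<open>x\<^sup>i\<close> in the span of higher powers would turn the last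
nonzero power of \<open>x\<close> into zero.\<close>

lemma powers_indep:
  assumes "nilpotent x" "(mul x ^^ n) x \<noteq> 0"
  shows "indep_list (map (\<lambda>i. (mul x ^^ i) x) [0..<Suc n])"
proof -
  let ?p = "\<lambda>i. (mul x ^^ i) x"
  obtain k where k: "?p k = 0" "\<And>j. ?p j = 0 \<Longrightarrow> k \<le> j"
    using assms(1) ex_has_least_nat[of "\<lambda>j. ?p j = 0" _ id] unfolding nilpotent_def by auto
  have pow: "(mul x ^^ i) (?p j) = ?p (i + j)" for i j by (simp add: funpow_add)
  have "indep_list (map ?p [i..<k])" if "i \<le> k" for i
    using that
  proof (induction rule: inc_induct)
    case (step i)
    let ?S = "set (map ?p [Suc i..<k])" and ?f = "mul x ^^ (k - Suc i)"
    have "?p i \<notin> span ?S"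
    proof
      assume "?p i \<in> span ?S"
      moreover have "subspace {y. ?f y = 0}"
        using module_hom.subspace_kernel[OF pow_linear[unfolded linear_iff_module_hom]] .
      moreover have "?S \<subseteq> {y. ?f y = 0}"
        using step.hyps by (auto simp: pow intro!: pow_eq_zero_mono[OF k(1)])
      ultimately have "?f (?p i) = 0" using span_minimal by blast
      then have "k \<le> k - Suc i + i" unfolding pow by (rule k(2))
      then show False using step.hyps by simp
    qed
    with step show ?case by (simp add: upt_conv_Cons)
  qed simp
  from this[of 0] have "indep_list (map ?p [0..<k])" by simp
  moreover have "Suc n \<le> k" using pow_eq_zero_mono[OF k(1)] assms(2) by (meson not_less_eq_eq)
  then have "[0..<k] = [0..<Suc n] @ [Suc n..<k]" by (metis le_add_diff_inverse upt_add_eq_append zero_le)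
  ultimately have "indep_list (map ?p [0..<Suc n] @ map ?p [Suc n..<k])"
    by (simp only: map_append)
  then show ?thesis by (rule indep_list_prefix)
qed

lemma pow_below_dim:
  assumes N: "nil_subalgebra N" and x: "x \<in> N" "(mul x ^^ n) x \<noteq> 0"
  shows "n < dim N"
proof -
  have "(mul x ^^ i) x \<in> N" for i
    using nil_subalgebraD(2)[OF N] x(1) by (induction i) simp_all
  then have "set (map (\<lambda>i. (mul x ^^ i) x) [0..<Suc n]) \<subseteq> N" by auto
  from indep_list_length_le[OF powers_indep[OF nil_subalgebraD(3)[OF N x(1)] x(2)] this]
  show ?thesis by simp
qed

lemma nil_presentedI:
  assumes N: "nil_subalgebra N" "T \<in> set (nil_tables (dim N))"
    and vs: "indep_list vs" "set vs \<subseteq> N" "length vs = dim N"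
    and T: "\<forall>i<length vs. \<forall>j<length vs. vs ! i \<odot> vs ! j = basis_value vs (entry T i j)"
      "\<forall>(a, b, c) \<in> set T. c < length vs"
  shows "nil_presented N"
  unfolding nil_presented_def
  using presentsI[OF nil_subalgebraD(1)[OF N(1)] vs(1,2) vs(3)[symmetric] T] N(2) by blast

lemmas check_table = All_less_Suc numeral_eq_Suc nil_tables_def

lemma null_presented:
  assumes N: "nil_subalgebra N" and zero: "\<And>x y. x \<in> N \<Longrightarrow> y \<in> N \<Longrightarrow> x \<odot> y = 0"
  shows "nil_presented N"
proof -
  obtain vs where vs: "indep_list vs" "span (set vs) = N" "length vs = dim N"
    using exists_basis_list[OF nil_subalgebraD(1)[OF N]] by blast
  then have "set vs \<subseteq> N" using span_superset by blast
  moreover from this have "\<forall>i<length vs. \<forall>j<length vs. vs ! i \<odot> vs ! j = 0"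
    using zero nth_mem by blast
  ultimately show ?thesis
    using vs by (intro nil_presentedI[OF N, of "[]" vs]) (simp_all add: nil_tables_def)
qed

lemma product_polarization:
  "x \<odot> y = (1/2) \<cdot> ((x + y) \<odot> (x + y) - x \<odot> x - y \<odot> y)"
proof -
  have "(x + y) \<odot> (x + y) - x \<odot> x - y \<odot> y = 2 \<cdot> (x \<odot> y)"
    using scale_left_distrib[of 1 1 "x \<odot> y"] by (simp add: mul_add comm)
  then show ?thesis by simp
qed

text \<open>Square roots in \<open>\<complex>\<close> remove the scalars from diagonalized quadratic forms.\<close>

lemma normalize_square:
  assumes "w \<odot> w = c \<cdot> u" "c \<noteq> 0"
  obtains a where "a \<noteq> 0" "(a \<cdot> w) \<odot> (a \<cdot> w) = u"
proof
  show "1 / csqrt c \<noteq> 0" using assms(2) by simp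
  have "(1 / csqrt c) * ((1 / csqrt c) * c) = 1"
    using assms(2) power2_csqrt[of c] by (simp add: field_simps power2_eq_square)
  then show "((1 / csqrt c) \<cdot> w) \<odot> ((1 / csqrt c) \<cdot> w) = u"
    by (simp only: mul_scale assms(1) scale_scale) simp
qed

lemma span_scaled:
  assumes "a \<noteq> 0" shows "a \<cdot> y \<in> span S \<longleftrightarrow> y \<in> span S"
proof
  assume "a \<cdot> y \<in> span S"
  then have "(1/a) \<cdot> (a \<cdot> y) \<in> span S" by (rule span_scale)
  with assms show "y \<in> span S" by simp
qed (rule span_scale)

lemma span_diff_iff: "x \<in> span S \<Longrightarrow> y - x \<in> span S \<longleftrightarrow> y \<in> span S"
  by (metis diff_add_cancel span_add span_diff)

lemma span_insertE:
  assumes "v \<in> span (insert a S)" obtains c w where "w \<in> span S" "v = c \<cdot> a + w"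
proof -
  obtain c where "v - c \<cdot> a \<in> span S" using assms span_breakdown_eq by blast
  then show thesis using that[of "v - c \<cdot> a" c] by simp
qed

lemma span_list3E:
  assumes "v \<in> span (set [a, b, c])" obtains p q r where "v = p \<cdot> a + q \<cdot> b + r \<cdot> c"
  using assms by (auto elim!: span_insertE simp: add_ac)

lemma span_list4E:
  assumes "v \<in> span (set [a, b, c, d])"
  obtains p q r s where "v = p \<cdot> a + q \<cdot> b + r \<cdot> c + s \<cdot> d"
  using assms by (auto elim!: span_insertE simp: add_ac)

text \<open>Here \<open>N\<close> is spanned by the powers of one element.\<close>

lemma cyclic_presented:
  assumes N: "nil_subalgebra N" and d: "dim N \<in> {2,3,4}" and x: "x \<in> N" "(mul x ^^ (dim N - 1)) x \<noteq> 0"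
  shows "nil_presented N"
proof -
  note indep = powers_indep[OF nil_subalgebraD(3)[OF N x(1)] x(2)]
  note mem = nil_subalgebraD(2)[OF N]
  have vanish: "(mul x ^^ n) x = 0" if "dim N \<le> n" for n
    using pow_below_dim[OF N x(1), of n] that by linarith
  consider "dim N = 2" | "dim N = 3" | "dim N = 4" using d by blast
  then show ?thesis
  proof cases
    case 1
    then have "x \<odot> (x \<odot> x) = 0" using vanish[of 2] by (simp add: numeral_2_eq_2)
    with 1 show ?thesis
      using indep x(1) mem
      by (intro nil_presentedI[OF N, of "[(0,0,1)]" "[x, x \<odot> x]"])
         (simp_all add: check_table upt_rec mul_ac)
  next
    case 2
    then have "x \<odot> (x \<odot> (x \<odot> x)) = 0" using vanish[of 3] by (simp add: numeral_3_eq_3)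
    with 2 show ?thesis
      using indep x(1) mem
      by (intro nil_presentedI[OF N, of "[(0,0,1),(0,1,2)]" "[x, x \<odot> x, x \<odot> (x \<odot> x)]"])
         (simp_all add: check_table upt_rec mul_ac)
  next
    case 3
    then have "x \<odot> (x \<odot> (x \<odot> (x \<odot> x))) = 0" using vanish[of 4] by (simp add: eval_nat_numeral)
    with 3 show ?thesis
      using indep x(1) mem
      by (intro nil_presentedI[OF N, of "[(0,0,1),(0,1,2),(0,2,3),(1,1,3)]"
            "[x, x \<odot> x, x \<odot> (x \<odot> x), x \<odot> (x \<odot> (x \<odot> x))]"])
         (simp_all add: check_table upt_rec mul_ac)
  qed
qed

text \<open>Adding the cubes of \<open>a + b\<close> and \<open>a - b\<close> gives \<open>6 ab\<^sup>2 = 0\<close>, and polarizing once more gives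
\<open>2 xyz = 0\<close>.\<close>

lemma cube_zero_imp_product_zero:
  assumes N: "nil_subalgebra N" and cube: "\<And>x. x \<in> N \<Longrightarrow> x \<odot> (x \<odot> x) = 0"
    and "x \<in> N" "y \<in> N" "z \<in> N"
  shows "x \<odot> (y \<odot> z) = 0"
proof -
  have double: "v = 0" if "v + v = 0" for v :: 'a
    using that scale_left_distrib[of 1 1 v] by simp
  have triple: "v = 0" if "v + v + v = 0" for v :: 'a
    using that scale_left_distrib[of 1 1 v] scale_left_distrib[of 2 1 v] by simp
  have cancel: "Q + Q = 0" if "0 = 0 + P + Q + 0" "0 = 0 - P + Q - 0" for P Q :: 'a
  proof -
    have "Q = P" using that(2) by (simp add: algebra_simps)
    with that(1) show ?thesis by simp
  qed
  have sq: "b \<odot> (b \<odot> a) = 0" if "a \<in> N" "b \<in> N" for a b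
  proof -
    let ?p = "a \<odot> (a \<odot> b)" and ?q = "b \<odot> (b \<odot> a)"
    have "(a + b) \<odot> ((a + b) \<odot> (a + b)) = a \<odot> (a \<odot> a) + (?p + ?p + ?p) + (?q + ?q + ?q) + b \<odot> (b \<odot> b)"
      by (simp only: mul_add) (simp add: mul_ac add_ac)
    moreover have "(a - b) \<odot> ((a - b) \<odot> (a - b)) = a \<odot> (a \<odot> a) - (?p + ?p + ?p) + (?q + ?q + ?q) - b \<odot> (b \<odot> b)"
      by (simp only: mul_diff) (simp add: mul_ac algebra_simps)
    ultimately have "0 = 0 + (?p + ?p + ?p) + (?q + ?q + ?q) + 0" "0 = 0 - (?p + ?p + ?p) + (?q + ?q + ?q) - 0"
      using cube[OF that(1)] cube[OF that(2)] cube[OF nil_subalgebraD(4)[OF N that]]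
        cube[OF nil_subalgebraD(5)[OF N that]] by simp_all
    then have "(?q + ?q + ?q) + (?q + ?q + ?q) = 0" by (rule cancel)
    then show ?thesis using double triple by blast
  qed
  have "y \<odot> (z \<odot> x) + y \<odot> (z \<odot> x) = 0"
    using sq[of x "y + z"] sq[of x y] sq[of x z] assms(3-5) nil_subalgebraD(4)[OF N]
    by (simp add: mul_add mul_ac)
  then show ?thesis using double by (metis mul_ac)
qed

text \<open>Complete \<open>x, x\<^sup>2, x\<^sup>3\<close> by a fourth vector. Nilpotency forces its product with \<open>x\<close> into the span of these
powers, and subtracting a combination of \<open>x\<close> and \<open>x\<^sup>2\<close> makes that product zero. The square of the
corrected vector \<open>z\<close> is then a multiple of \<open>x\<^sup>3\<close>, and it can be scaled to be \<open>0\<close> or \<open>x\<^sup>3\<close>.\<close>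

lemma third_power_presented:
  assumes N: "nil_subalgebra N" and d: "dim N = 4"
    and x: "x \<in> N" "x \<odot> (x \<odot> x) \<noteq> 0" and x4: "x \<odot> (x \<odot> (x \<odot> x)) = 0"
  shows "nil_presented N"
proof -
  note D = nil_subalgebraD[OF N]
  define u where "u = x \<odot> x"
  define t where "t = x \<odot> u"
  have xt: "x \<odot> t = 0" "t \<odot> x = 0" and ut: "u \<odot> t = 0" "t \<odot> u = 0"
    and uu: "u \<odot> u = 0" and tt: "t \<odot> t = 0" and ux: "u \<odot> x = t"
    using x4 by (simp_all add: u_def t_def mul_ac)
  have mem: "u \<in> N" "t \<in> N" using x(1) D(2) by (simp_all add: u_def t_def)
  have "(mul x ^^ 2) x \<noteq> 0" using x(2) by (simp add: numeral_2_eq_2)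
  from powers_indep[OF D(3)[OF x(1)] this] have indep: "indep_list [x, u, t]"
    by (simp add: u_def t_def numeral_2_eq_2)
  have xu: "x \<odot> u = t" and xx: "x \<odot> x = u" by (simp_all add: u_def t_def)
  have ut_indep: "a = 0 \<and> b = 0" if "a \<cdot> u + b \<cdot> t = 0" for a b
  proof -
    have "x \<odot> (a \<cdot> u + b \<cdot> t) = a \<cdot> t" by (simp add: mul_distribs xt xu)
    with that indep show ?thesis by (auto simp: span_0)
  qed
  let ?S = "span (set [x, u, t])"
  have gen: "x \<in> ?S" "u \<in> ?S" "t \<in> ?S" by (simp_all add: span_base)
  have comb: "a \<cdot> x + b \<cdot> u + c \<cdot> t \<in> ?S" for a b c
    using gen by (intro span_add span_scale)
  have S_inv: "x \<odot> v \<in> ?S" if "v \<in> ?S" for v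
  proof -
    obtain a b c where "v = a \<cdot> x + b \<cdot> u + c \<cdot> t" using \<open>v \<in> ?S\<close> by (rule span_list3E)
    then have "x \<odot> v = 0 \<cdot> x + a \<cdot> u + b \<cdot> t" by (simp add: mul_distribs xx xu xt)
    then show ?thesis using comb by metis
  qed
  have "length [x, u, t] < dim N" using d by simp
  then obtain y where y: "y \<in> N" "y \<notin> ?S" by (rule exists_outside_span)
  have basis: "indep_list [x, u, y', t]" if "y' \<notin> ?S" for y'
    by (rule indep_list_cong[of "[y', x, u, t]"]) (use indep that in auto)
  have expand: "\<exists>a b c e. v = a \<cdot> x + b \<cdot> u + c \<cdot> t + e \<cdot> y'" if "v \<in> N" "y' \<in> N" "y' \<notin> ?S" for v y'
  proof -
    have "span (set [x, u, y', t]) = N"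
      using basis[OF \<open>y' \<notin> ?S\<close>] D(1) d x(1) mem \<open>y' \<in> N\<close> by (intro indep_list_spans) simp_all
    with \<open>v \<in> N\<close> show ?thesis
      by (auto elim!: span_insertE) (metis add.commute add.left_commute add.right_neutral)
  qed
  obtain a b c e where xy: "x \<odot> y = a \<cdot> x + b \<cdot> u + c \<cdot> t + e \<cdot> y"
    using expand[OF D(2)[OF x(1) y(1)] y] by blast
  \<comment> \<open>Modulo the span of the powers of \<open>x\<close>, multiplication by \<open>x\<close> is the scalar \<open>e\<close>, which is therefore zero.\<close>
  have "(mul x ^^ n) y - e ^ n \<cdot> y \<in> ?S" for n
  proof (induction n)
    case (Suc n)
    have "x \<odot> ((mul x ^^ n) y) - e ^ Suc n \<cdot> y
        = x \<odot> ((mul x ^^ n) y - e ^ n \<cdot> y) + e ^ n \<cdot> (a \<cdot> x + b \<cdot> u + c \<cdot> t)"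
      by (simp add: mul_distribs xy scale_right_distrib mult.commute)
    also have "\<dots> \<in> ?S" using span_add[OF S_inv[OF Suc] span_scale[OF comb]] .
    finally show ?case by simp
  qed (simp add: span_zero)
  moreover obtain n where "\<forall>z. (mul x ^^ n) z = 0" using nilpotent_kills[OF D(3)[OF x(1)]] by blast
  ultimately have "0 - e ^ n \<cdot> y \<in> ?S" by metis
  then have "e ^ n \<cdot> y \<in> ?S" using span_neg by fastforce
  with y(2) span_scaled[of "e ^ n" y] have e0: "e = 0" by auto
  define z where "z = y - (b \<cdot> x + c \<cdot> u)"
  have zN: "z \<in> N" unfolding z_def using x(1) mem y(1) D by simp
  have zS: "z \<notin> ?S"
    unfolding z_def using y(2) gen by (subst span_diff_iff) (auto intro: span_add span_scale)
  have "x \<odot> z = a \<cdot> x" by (simp add: z_def mul_distribs xy e0 xx xu)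
  then have "z \<odot> x = a \<cdot> x" by (simp add: comm)
  moreover have "x \<noteq> 0" using x(2) by auto
  ultimately have "a = 0" using nilpotent_eigenvalue D(3)[OF zN] by blast
  with \<open>x \<odot> z = a \<cdot> x\<close> have xz: "x \<odot> z = 0" "z \<odot> x = 0" by (simp_all add: comm)
  have uz: "u \<odot> z = 0" "z \<odot> u = 0" and tz: "t \<odot> z = 0" "z \<odot> t = 0"
    using xz by (simp_all add: u_def t_def mul_ac)
  obtain a' b' c' e' where zz: "z \<odot> z = a' \<cdot> x + b' \<cdot> u + c' \<cdot> t + e' \<cdot> z"
    using expand[OF D(2)[OF zN zN] zN zS] by blast
  have "x \<odot> (z \<odot> z) = a' \<cdot> u + b' \<cdot> t" unfolding zz by (simp add: mul_distribs xx xu xt xz)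
  moreover have "x \<odot> (z \<odot> z) = 0" by (simp add: xz flip: assoc)
  ultimately have "a' = 0" "b' = 0" using ut_indep by metis+
  with zz have zz': "z \<odot> z = c' \<cdot> t + e' \<cdot> z" by simp
  have "z \<odot> (z \<odot> z) = e' \<cdot> (z \<odot> z)" by (subst (1) zz') (simp add: mul_distribs tz)
  then have "z \<odot> z = 0 \<or> e' = 0" using nilpotent_eigenvalue D(3)[OF zN] by blast
  then consider "z \<odot> z = 0" | "z \<odot> z \<noteq> 0" "z \<odot> z = c' \<cdot> t" using zz' by force
  then show ?thesis
  proof cases
    case 1
    have "indep_list [x, u, t, z]" by (rule indep_list_cong[OF basis[OF zS]]) auto
    then show ?thesis
      using x(1) mem zN d
      by (intro nil_presentedI[OF N, of "[(0,0,1),(0,1,2)]" "[x, u, t, z]"])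
         (simp_all add: check_table xx xu xt ux ut uu tt xz uz tz 1)
  next
    case 2
    then have "c' \<noteq> 0" by auto
    then obtain r where r: "r \<noteq> 0" "(r \<cdot> z) \<odot> (r \<cdot> z) = t"
      using normalize_square[OF 2(2)] by blast
    have "r \<cdot> z \<notin> ?S" using zS r(1) by (simp only: span_scaled not_False_eq_True)
    from basis[OF this] show ?thesis
      using x(1) mem zN d D(6) r(2)
      by (intro nil_presentedI[OF N, of "[(0,0,1),(0,1,3),(2,2,3)]" "[x, u, r \<cdot> z, t]"])
         (simp_all add: check_table xx xu xt ux ut uu tt xz uz tz mul_scale)
  qed
qed

text \<open>Let \<open>u = x\<^sup>2\<close> and \<open>v = y\<^sup>2\<close> be independent. Then \<open>x, y, u, v\<close> is a basis and \<open>xy = pu + qv\<close>, so the only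
quadratic relation on \<open>x, y\<close> is given by the form \<open>XY - pX\<^sup>2 - qY\<^sup>2\<close>. If its discriminant
\<open>1 - 4pq\<close> vanishes, the form is the square of a linear one and yields an element \<open>e\<close> of square zero;
otherwise it is a product of two independent linear forms, which yields \<open>a, b\<close> with \<open>ab = 0\<close>.\<close>

lemma two_squares_presented:
  assumes N: "nil_subalgebra N" and N3: "\<And>x y z. x \<in> N \<Longrightarrow> y \<in> N \<Longrightarrow> z \<in> N \<Longrightarrow> x \<odot> (y \<odot> z) = 0"
    and d: "dim N \<le> 4"
    and x: "x \<in> N" "x \<odot> x \<noteq> 0" and y: "y \<in> N" "y \<odot> y \<notin> span {x \<odot> x}"
  shows "nil_presented N"
proof -
  note D = nil_subalgebraD[OF N]
  define u v w where "u = x \<odot> x" and "v = y \<odot> y" and "w = x \<odot> y"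
  have mem: "u \<in> N" "v \<in> N" "w \<in> N" using x y D(2) by (simp_all add: u_def v_def w_def)
  have prods: "x \<odot> x = u" "y \<odot> y = v" "x \<odot> y = w" "y \<odot> x = w"
    by (simp_all add: u_def v_def w_def comm)
  have triple: "a \<odot> u = 0" "a \<odot> v = 0" "a \<odot> w = 0" "u \<odot> a = 0" "v \<odot> a = 0" "w \<odot> a = 0" if "a \<in> N" for a
    using N3[OF that] x(1) y(1) comm by (auto simp: u_def v_def w_def)
  have vu: "v \<notin> span {u}" using y(2) by (simp add: u_def v_def)
  have "u \<noteq> 0" using x(2) by (simp add: u_def)
  have dep: "\<alpha> = 0 \<and> \<beta> = 0" if "\<alpha> \<cdot> u + \<beta> \<cdot> w = 0" "\<alpha> \<cdot> w + \<beta> \<cdot> v = 0" for \<alpha> \<beta>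
  proof (cases "\<beta> = 0")
    case True
    with that(1) \<open>u \<noteq> 0\<close> show ?thesis by simp
  next
    case False
    have "\<beta> \<cdot> w \<in> span {u}"
      using that(1) by (metis add_eq_0_iff span_base span_neg span_scale singletonI)
    then have "w \<in> span {u}" using False by (simp only: span_scaled not_False_eq_True)
    then have "\<beta> \<cdot> v \<in> span {u}"
      using that(2) by (metis add_eq_0_iff span_neg span_scale)
    with vu False show ?thesis by (simp add: span_scaled)
  qed
  have comb: "x \<odot> (a \<cdot> x + b \<cdot> y + p \<cdot> u + q \<cdot> v) = a \<cdot> u + b \<cdot> w"
    "y \<odot> (a \<cdot> x + b \<cdot> y + p \<cdot> u + q \<cdot> v) = a \<cdot> w + b \<cdot> v" for a b p q
    using x(1) y(1) by (simp_all add: mul_add mul_scale prods triple)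
  have "x \<notin> span {y, u, v}"
  proof
    assume "x \<in> span {y, u, v}"
    then obtain b p q where "x = b \<cdot> y + p \<cdot> u + q \<cdot> v" using span_list3E[of x y u v] by auto
    then have "x = 0 \<cdot> x + b \<cdot> y + p \<cdot> u + q \<cdot> v" by simp
    with comb[of 0 b p q] have "x \<odot> x = b \<cdot> w" "y \<odot> x = b \<cdot> v" by simp_all
    then show False using dep[of 1 "- b"] by (simp add: prods)
  qed
  moreover have "y \<notin> span {u, v}"
  proof
    assume "y \<in> span {u, v}"
    then obtain p q where "y = 0 \<cdot> x + 0 \<cdot> y + p \<cdot> u + q \<cdot> v" by (auto elim!: span_insertE)
    with comb[of 0 0 p q] have "y \<odot> y = 0" by simp
    with vu show False by (simp add: prods span_zero)
  qed
  moreover have "indep_list [v, u]" using vu \<open>u \<noteq> 0\<close> by simp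
  then have "indep_list [u, v]" by (rule indep_list_cong) auto
  ultimately have indep: "indep_list [x, y, u, v]" by simp
  have in_N: "set [x, y, u, v] \<subseteq> N" using x(1) y(1) mem by simp
  have d4: "dim N = 4" using indep_list_length_le[OF indep in_N] d by simp
  have span: "span (set [x, y, u, v]) = N"
    using indep_list_spans[OF indep in_N D(1)] d4 by simp
  obtain a b p q where w0: "w = a \<cdot> x + b \<cdot> y + p \<cdot> u + q \<cdot> v"
    using mem(3) span span_list4E[of w x y u v] by metis
  have "a = 0 \<and> b = 0"
    using dep comb[of a b p q] triple(3)[OF x(1)] triple(3)[OF y(1)] unfolding w0[symmetric] by simp
  with w0 have w: "w = p \<cdot> u + q \<cdot> v" by simp
  have mult: "(a \<cdot> x + b \<cdot> y) \<odot> (a' \<cdot> x + b' \<cdot> y)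
      = (a * a' + (a * b' + b * a') * p) \<cdot> u + (b * b' + (a * b' + b * a') * q) \<cdot> v" for a b a' b'
    by (simp add: mul_add mul_scale prods w scale_left_distrib scale_right_distrib algebra_simps)
  have spans: "N \<subseteq> S" if "subspace S" "x \<in> S" "y \<in> S" "u \<in> S" "v \<in> S" for S
    using that span_minimal[of "set [x, y, u, v]" S] span by simp
  show ?thesis
  proof (cases "4 * p * q = 1")
    case True
    define e where "e = 1 \<cdot> x + (- 2 * q) \<cdot> y"
    define f where "f = e \<odot> y"
    have ee: "e \<odot> e = 0"
      unfolding e_def mult using True by (simp add: algebra_simps)
    have f: "f = p \<cdot> u - q \<cdot> v"
      using mult[of 1 "- 2 * q" 0 1] by (simp add: f_def e_def algebra_simps)
    have ye: "y \<odot> e = f" "e \<odot> y = f" by (simp_all add: f_def comm)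
    have memN: "e \<in> N" "f \<in> N" using x(1) y(1) D by (simp_all add: f_def e_def)
    have fz: "a \<odot> f = 0" "f \<odot> a = 0" if "a \<in> N" for a
      using N3[OF that memN(1) y(1)] by (simp_all add: f_def comm)
    let ?S = "span (set [e, y, v, f])"
    have gen: "e \<in> ?S" "y \<in> ?S" "v \<in> ?S" "f \<in> ?S" by (simp_all add: span_base)
    have "x = e + (2 * q) \<cdot> y" by (simp add: e_def)
    also have "\<dots> \<in> ?S" using gen by (intro span_add span_scale)
    finally have "x \<in> ?S" .
    moreover have "u \<in> ?S"
    proof -
      have "p \<noteq> 0" using True by auto
      then have "u = (1 / p) \<cdot> (f + q \<cdot> v)" by (simp add: f)
      also have "\<dots> \<in> ?S" using gen by (intro span_add span_scale)
      finally show ?thesis .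
    qed
    ultimately have "N \<subseteq> ?S" using gen by (intro spans) simp_all
    then have "indep_list [e, y, v, f]"
      using memN y(1) mem d4 by (intro spanning_indep_list) (simp_all add: numeral_eq_Suc)
    then show ?thesis
      using memN y(1) mem d4
      by (intro nil_presentedI[OF N, of "[(0,1,3),(1,1,2)]" "[e, y, v, f]"])
         (simp_all add: check_table ee ye prods triple fz)
  next
    case False
    \<comment> \<open>For \<open>a = x + sy\<close> and \<open>b = y + tx\<close> one has \<open>ab = (t + kp)u + (s + kq)v\<close> with \<open>k = 1 + st\<close>, so \<open>ab = 0\<close>
      means \<open>pqk\<^sup>2 - k + 1 = 0\<close>; its root \<open>2 / (1 + r)\<close> also makes sense for \<open>pq = 0\<close>.\<close>
    obtain r where r: "r * r = 1 - 4 * p * q" "1 + r \<noteq> 0"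
    proof (cases "1 + csqrt (1 - 4 * p * q) = 0")
      case True
      then have "csqrt (1 - 4 * p * q) = -1" by (simp add: add_eq_0_iff)
      with that[of 1] show ?thesis using power2_csqrt[of "1 - 4 * p * q"] by simp
    next
      case False
      with that show ?thesis using power2_csqrt[of "1 - 4 * p * q"] by (metis power2_eq_square)
    qed
    have "r \<noteq> 0" using r(1) False by auto
    define k where "k = 2 / (1 + r)"
    have k: "k * (1 + r) = 2" by (rule nonzero_eq_divide_eq[THEN iffD1, OF r(2) k_def])
    have kpq: "2 * (k * k * (p * q)) = (1 - r) * k"
    proof -
      have "4 * (k * k * (p * q)) = k * k * (1 - r * r)" using r(1) by simp
      also have "\<dots> = (k * (1 + r)) * (k * (1 - r))" by (simp add: algebra_simps)
      also have "\<dots> = 2 * (k * (1 - r))" by (simp only: k)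
      finally have "2 * (2 * (k * k * (p * q))) = 2 * ((1 - r) * k)"
        by (simp only: mult.assoc[symmetric] mult.commute[of k "1 - r"]) simp
      then show ?thesis by (simp only: mult_cancel_left) simp
    qed
    have "2 * (k * k * (p * q)) = 2 * k - k * (1 + r)"
      unfolding kpq by (simp add: algebra_simps)
    also have "\<dots> = 2 * (k - 1)" by (simp only: k) simp
    finally have root: "k * k * (p * q) = k - 1" by (simp only: mult_cancel_left) simp
    define s t where "s = - k * q" and "t = - k * p"
    have st: "s * t = k - 1" using root by (simp add: s_def t_def algebra_simps)
    have "1 - s * t \<noteq> 0"
    proof
      assume "1 - s * t = 0"
      then have "k = 2" using st by (simp add: algebra_simps)
      with k \<open>r \<noteq> 0\<close> show False by simp
    qed
    define a b where "a = 1 \<cdot> x + s \<cdot> y" and "b = t \<cdot> x + 1 \<cdot> y"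
    have "1 * 1 + s * t = k" using st by simp
    then have ab: "a \<odot> b = 0" "b \<odot> a = 0"
      unfolding comm[of b a] unfolding a_def b_def mult by (simp_all add: s_def t_def)
    have memN: "a \<in> N" "b \<in> N" "a \<odot> a \<in> N" "b \<odot> b \<in> N" using x(1) y(1) D by (simp_all add: a_def b_def)
    let ?S = "span (set [a, b, a \<odot> a, b \<odot> b])"
    have gen: "a \<in> ?S" "b \<in> ?S" "a \<odot> a \<in> ?S" "b \<odot> b \<in> ?S" by (simp_all add: span_base)
    define c where "c = 1 / (1 - s * t)"
    have c: "c * (1 - s * t) = 1" using \<open>1 - s * t \<noteq> 0\<close> by (simp add: c_def)
    have "a - s \<cdot> b = (1 - s * t) \<cdot> x" "b - t \<cdot> a = (1 - s * t) \<cdot> y"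
      by (simp_all add: a_def b_def scale_right_distrib scale_left_diff_distrib mult.commute)
    then have xy: "x = c \<cdot> (a - s \<cdot> b)" "y = c \<cdot> (b - t \<cdot> a)" using c by simp_all
    have "x \<in> ?S" "y \<in> ?S"
      unfolding xy using gen by (simp_all only: span_scale span_diff)
    moreover have "u \<in> ?S" "v \<in> ?S"
    proof -
      have "u = (c * c) \<cdot> (a \<odot> a + (s * s) \<cdot> (b \<odot> b))"
        unfolding u_def by (subst (1 2) xy(1)) (simp add: mul_distribs ab scale_right_distrib mult_ac)
      moreover have "v = (c * c) \<cdot> (b \<odot> b + (t * t) \<cdot> (a \<odot> a))"
        unfolding v_def by (subst (1 2) xy(2)) (simp add: mul_distribs ab scale_right_distrib mult_ac)
      ultimately show "u \<in> ?S" "v \<in> ?S"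
        using gen by (simp_all only: span_add span_scale)
    qed
    ultimately have "N \<subseteq> ?S" by (intro spans) simp_all
    then have "indep_list [a, b, a \<odot> a, b \<odot> b]"
      using memN d4 by (intro spanning_indep_list) (simp_all add: numeral_eq_Suc)
    then show ?thesis
      using memN d4
      by (intro nil_presentedI[OF N, of "[(0,0,2),(1,1,3)]" "[a, b, a \<odot> a, b \<odot> b]"])
         (simp_all add: check_table ab N3 assoc)
  qed
qed

text \<open>Here the product is one quadratic form with values in \<open>\<complex>x\<^sup>2\<close>. It is diagonalized by splitting off
vectors orthogonal to the previous ones, that is, with product zero.\<close>

lemma one_square_presented:
  assumes N: "nil_subalgebra N" and N3: "\<And>x y z. x \<in> N \<Longrightarrow> y \<in> N \<Longrightarrow> z \<in> N \<Longrightarrow> x \<odot> (y \<odot> z) = 0"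
    and d: "dim N \<le> 4"
    and x: "x \<in> N" "x \<odot> x \<noteq> 0" and line: "\<And>y. y \<in> N \<Longrightarrow> y \<odot> y \<in> span {x \<odot> x}"
  shows "nil_presented N"
proof -
  note D = nil_subalgebraD[OF N]
  define u where "u = x \<odot> x"
  have u: "u \<in> N" "u \<noteq> 0" using x D(2) by (simp_all add: u_def)
  have xx: "x \<odot> x = u" by (simp add: u_def)
  have uz: "u \<odot> y = 0" "y \<odot> u = 0" if "y \<in> N" for y
    using N3[OF that x(1) x(1)] by (simp_all add: u_def comm)
  have "(mul x ^^ 1) x \<noteq> 0" using x(2) by simp
  from powers_indep[OF D(3)[OF x(1)] this] have xu: "indep_list [x, u]"
    by (simp add: u_def)
  have form: "\<exists>c. y \<odot> z = c \<cdot> u" if "y \<in> N" "z \<in> N" for y z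
  proof -
    have "y \<odot> z \<in> span {u}"
      unfolding product_polarization[of y z] u_def using line D that
      by (intro span_scale span_diff) simp_all
    then show ?thesis by (auto elim!: span_insertE)
  qed
  have perp: "\<exists>z \<in> N. z \<notin> span S \<and> x \<odot> z = 0" if y: "y \<in> N" "y \<notin> span S" "x \<in> S" for y S
  proof -
    obtain c where c: "x \<odot> y = c \<cdot> u" using form[OF x(1) y(1)] by blast
    have cx: "c \<cdot> x \<in> span S" using y(3) by (intro span_scale span_base)
    have "y - c \<cdot> x \<in> N" using y(1) x(1) D by simp
    moreover have "y - c \<cdot> x \<notin> span S" using span_diff_iff[OF cx] y(2) by blast
    moreover have "x \<odot> (y - c \<cdot> x) = 0" by (simp add: mul_distribs c xx)
    ultimately show ?thesis by blast
  qed
  have "2 \<le> dim N" using indep_list_length_le[OF xu, of N] x(1) u(1) by simp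
  with d consider "dim N = 2" | "dim N = 3" | "dim N = 4" by linarith
  note cases_dim = this
  show ?thesis
  proof (cases "\<exists>w \<in> N. x \<odot> w = 0 \<and> w \<odot> w \<noteq> 0")
    case False
    have sq0: "y \<odot> y = 0" if "y \<in> N" "x \<odot> y = 0" for y using False that by blast
    have prod0: "y \<odot> z = 0" if "y \<in> N" "x \<odot> y = 0" "z \<in> N" "x \<odot> z = 0" for y z
    proof -
      have "(y + z) \<odot> (y + z) = 0"
        using that D by (intro sq0) (simp_all add: mul_add)
      then show ?thesis using product_polarization[of y z] sq0 that by simp
    qed
    from cases_dim show ?thesis
    proof cases
      case 1
      then show ?thesis using xu x(1) u uz
        by (intro nil_presentedI[OF N, of "[(0,0,1)]" "[x, u]"]) (simp_all add: check_table xx)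
    next
      case 2
      then obtain y where "y \<in> N" "y \<notin> span (set [x, u])"
        using exists_outside_span[of "[x, u]" N] by auto
      then obtain z where z: "z \<in> N" "z \<notin> span (set [x, u])" "x \<odot> z = 0"
        using perp[of y "set [x, u]"] by auto
      have "indep_list [x, u, z]" by (rule indep_list_cong[of "[z, x, u]"]) (use xu z in auto)
      then show ?thesis using 2 x(1) u uz z
        by (intro nil_presentedI[OF N, of "[(0,0,1)]" "[x, u, z]"])
           (simp_all add: check_table xx sq0 comm[of z x])
    next
      case 3
      then obtain y where "y \<in> N" "y \<notin> span (set [x, u])"
        using exists_outside_span[of "[x, u]" N] by auto
      then obtain z where z: "z \<in> N" "z \<notin> span (set [x, u])" "x \<odot> z = 0"
        using perp[of y "set [x, u]"] by auto
      from 3 obtain y' where "y' \<in> N" "y' \<notin> span (set [z, x, u])"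
        using exists_outside_span[of "[z, x, u]" N] by auto
      then obtain z' where z': "z' \<in> N" "z' \<notin> span (set [z, x, u])" "x \<odot> z' = 0"
        using perp[of y' "set [z, x, u]"] by auto
      have "indep_list [x, u, z, z']" by (rule indep_list_cong[of "[z', z, x, u]"]) (use xu z z' in auto)
      then show ?thesis using 3 x(1) u uz z z'
        by (intro nil_presentedI[OF N, of "[(0,0,1)]" "[x, u, z, z']"])
           (simp_all add: check_table xx sq0 prod0 comm[of z x] comm[of z' x])
    qed
  next
    case True
    then obtain w0 where w0: "w0 \<in> N" "x \<odot> w0 = 0" "w0 \<odot> w0 \<noteq> 0" by blast
    then obtain c where "w0 \<odot> w0 = c \<cdot> u" using form by blast
    with w0(3) obtain r where r: "r \<noteq> 0" "(r \<cdot> w0) \<odot> (r \<cdot> w0) = u"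
      using normalize_square[of w0 c u] by auto
    define w where "w = r \<cdot> w0"
    have w: "w \<in> N" "w \<odot> w = u" "x \<odot> w = 0" "w \<odot> x = 0"
      using w0 r D by (simp_all add: w_def mul_scale comm)
    have "w \<notin> span (set [x, u])"
    proof
      assume "w \<in> span (set [x, u])"
      then obtain a b where ab: "w = a \<cdot> x + b \<cdot> u" by (auto elim!: span_insertE)
      then have "x \<odot> w = a \<cdot> u" using uz[OF x(1)] by (simp add: mul_distribs xx)
      with w(3) u(2) ab have "w = b \<cdot> u" by simp
      then have "w \<odot> w = 0" using uz[OF w(1)] by (simp add: mul_scale)
      with w(2) u(2) show False by simp
    qed
    then have wxu: "indep_list [w, x, u]" using xu by simp
    from cases_dim show ?thesis
    proof cases
      case 1
      with indep_list_length_le[OF wxu, of N] w x(1) u show ?thesis by simp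
    next
      case 2
      have "indep_list [x, w, u]" by (rule indep_list_cong[OF wxu]) auto
      then show ?thesis using 2 x(1) u uz w
        by (intro nil_presentedI[OF N, of "[(0,0,2),(1,1,2)]" "[x, w, u]"])
           (simp_all add: check_table xx)
    next
      case 3
      then obtain y where "y \<in> N" "y \<notin> span (set [w, x, u])"
        using exists_outside_span[of "[w, x, u]" N] by auto
      then obtain z0 where z0: "z0 \<in> N" "z0 \<notin> span (set [w, x, u])" "x \<odot> z0 = 0"
        using perp[of y "set [w, x, u]"] by auto
      obtain b where b: "w \<odot> z0 = b \<cdot> u" using form[OF w(1) z0(1)] by blast
      define z where "z = z0 - b \<cdot> w"
      have bw: "b \<cdot> w \<in> span (set [w, x, u])" by (intro span_scale span_base) simp
      have z: "z \<in> N" "x \<odot> z = 0" "w \<odot> z = 0" "z \<notin> span (set [w, x, u])"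
        using z0 w D b span_diff_iff[OF bw] by (simp_all add: z_def mul_distribs)
      obtain c where c: "z \<odot> z = c \<cdot> u" using form[OF z(1) z(1)] by blast
      show ?thesis
      proof (cases "c = 0")
        case True
        have "indep_list [x, w, u, z]" by (rule indep_list_cong[of "[z, w, x, u]"]) (use wxu z in auto)
        then show ?thesis using 3 x(1) u uz w z c True
          by (intro nil_presentedI[OF N, of "[(0,0,2),(1,1,2)]" "[x, w, u, z]"])
             (simp_all add: check_table xx comm[of z x] comm[of z w])
      next
        case False
        then obtain s where s: "s \<noteq> 0" "(s \<cdot> z) \<odot> (s \<cdot> z) = u"
          using normalize_square[OF c] by blast
        have "s \<cdot> z \<notin> span (set [w, x, u])" using z(4) s(1) by (simp only: span_scaled not_False_eq_True)
        then have "indep_list [s \<cdot> z, w, x, u]" using wxu by simp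
        then have "indep_list [x, w, s \<cdot> z, u]" by (rule indep_list_cong) auto
        then show ?thesis using 3 x(1) u uz w z s(2) D(6)
          by (intro nil_presentedI[OF N, of "[(0,0,3),(1,1,3),(2,2,3)]" "[x, w, s \<cdot> z, u]"])
             (simp_all add: check_table xx mul_scale comm[of z x] comm[of z w])
      qed
    qed
  qed
qed

theorem nilpotent_classification:
  assumes N: "nil_subalgebra N" and d: "dim N \<le> 4"
  shows "nil_presented N"
proof -
  note D = nil_subalgebraD[OF N]
  have vanish: "(mul x ^^ n) x = 0" if "x \<in> N" "dim N \<le> n" for n x
    using pow_below_dim[OF N that(1), of n] that by linarith
  consider x where "x \<in> N" "x \<odot> (x \<odot> x) \<noteq> 0" | "\<And>x. x \<in> N \<Longrightarrow> x \<odot> (x \<odot> x) = 0" by blast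
  then show ?thesis
  proof cases
    case (1 x)
    then have p2: "(mul x ^^ 2) x \<noteq> 0" by (simp add: numeral_2_eq_2)
    have "2 < dim N" using pow_below_dim[OF N 1(1) p2] .
    with d consider "dim N = 3" | "dim N = 4" by linarith
    then show ?thesis
    proof cases
      case 1
      then show ?thesis using cyclic_presented[OF N _ \<open>x \<in> N\<close>] p2 by simp
    next
      case 2
      show ?thesis
      proof (cases "(mul x ^^ 3) x = 0")
        case True
        then show ?thesis
          using third_power_presented[OF N 2 \<open>x \<in> N\<close> \<open>x \<odot> (x \<odot> x) \<noteq> 0\<close>] by (simp add: numeral_3_eq_3)
      next
        case False
        then show ?thesis using cyclic_presented[OF N _ \<open>x \<in> N\<close>] 2 by simp
      qed
    qed
  next
    case 2
    have N3: "x \<odot> (y \<odot> z) = 0" if "x \<in> N" "y \<in> N" "z \<in> N" for x y z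
      using cube_zero_imp_product_zero[OF N 2 that] .
    show ?thesis
    proof (cases "\<exists>x \<in> N. x \<odot> x \<noteq> 0")
      case False
      then have "x \<odot> y = 0" if "x \<in> N" "y \<in> N" for x y
        using product_polarization[of x y] that D(4)[OF that] by simp
      then show ?thesis by (rule null_presented[OF N])
    next
      case True
      then obtain x where x: "x \<in> N" "x \<odot> x \<noteq> 0" by blast
      show ?thesis
      proof (cases "\<exists>y \<in> N. y \<odot> y \<notin> span {x \<odot> x}")
        case True
        then show ?thesis using two_squares_presented[OF N N3 d x] by blast
      next
        case False
        then show ?thesis by (intro one_square_presented[OF N N3 d x]) blast+
      qed
    qed
  qed
qed

end

section \<open>Every algebra occurs in the list\<close>

text \<open>Either the algebra is nilpotent, or a local summand with maximal ideal of dimension \<open>m\<close> splits off.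
The same algebra may occur several times, since its local factors can be split off in any order.\<close>

fun tables :: "nat \<Rightarrow> monomial_table list" where
  "tables d = map entry (nil_tables d) @
     concat (map (\<lambda>m. concat (map (\<lambda>S. map (split_table m (entry S)) (tables (d - Suc m))) (nil_tables m)))
       [0..<d])"

declare tables.simps [simp del]

context findim_comm_algebra begin

theorem algebra_classification:
  assumes "subalgebra V" "dim V \<le> 4"
  shows "\<exists>vs. \<exists>T \<in> set (tables (dim V)). presents V vs T"
  using assms
proof (induction "dim V" arbitrary: V rule: less_induct)
  case less
  show ?case
  proof (cases "\<forall>x\<in>V. nilpotent x")
    case True
    then have "nil_presented V"
      using less.prems by (intro nilpotent_classification) (simp_all add: nil_subalgebra_def)
    then show ?thesis
      unfolding nil_presented_def tables.simps[of "dim V"] by auto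
  next
    case False
    then obtain x where x: "x \<in> V" "\<not> nilpotent x" by blast
    obtain e M W where *: "subalgebra M" "subalgebra W" "\<And>x. x \<in> M \<Longrightarrow> nilpotent x"
      "e \<in> V" "e \<odot> e = e" "e \<notin> M"
      "\<And>x. x \<in> M \<Longrightarrow> x \<in> V \<and> e \<odot> x = x" "\<And>x. x \<in> W \<Longrightarrow> x \<in> V \<and> e \<odot> x = 0"
      "\<And>v. v \<in> V \<Longrightarrow> \<exists>c m w. m \<in> M \<and> w \<in> W \<and> v = c \<cdot> e + m + w"
      by (rule local_splitting[OF less.prems(1) x]; rule that; assumption)
    note split = presents_split[OF _ _ *(4-8) subalgebraD(1)[OF less.prems(1)] *(9)]
    have "nil_subalgebra M" using *(1,3) by (simp add: nil_subalgebra_def)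
    moreover have "M \<subseteq> V" using *(7) by blast
    then have dM: "dim M \<le> dim V" by (rule dim_subset)
    ultimately have "nil_presented M" using less.prems(2) by (intro nilpotent_classification) simp_all
    then obtain ms S where S: "S \<in> set (nil_tables (dim M))" "presents M ms (entry S)"
      unfolding nil_presented_def by blast
    obtain ws where ws: "indep_list ws" "span (set ws) = W" "length ws = dim W"
      using exists_basis_list[OF subalgebraD(1)[OF *(2)]] by blast
    have "dim W < dim V"
    proof -
      have "W \<subseteq> V" using *(8) by blast
      moreover have "e \<notin> W" using *(5,8) \<open>e \<notin> M\<close> subalgebraD(1)[OF *(1)] subspace_0 by force
      ultimately have "\<not> dim V \<le> dim W"
        using subspace_dim_equal[of W V] subalgebraD(1)[OF *(2)] subalgebraD(1)[OF less.prems(1)] *(4) by blast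
      then show ?thesis by simp
    qed
    then obtain vs T where T: "T \<in> set (tables (dim W))" "presents W vs T"
      using less.hyps[OF _ *(2)] less.prems(2) by force
    have P: "presents V (e # ms @ vs) (split_table (dim M) (entry S) T)"
      using split[OF S(2) T(2)] presents_dim[OF S(2)] by simp
    have "dim V = Suc (dim M + dim W)"
      using presents_dim[OF P] presents_dim[OF S(2)] presents_dim[OF T(2)] by simp
    then have "dim M < dim V" "dim V - Suc (dim M) = dim W" by simp_all
    with S(1) T(1) have "split_table (dim M) (entry S) T \<in> set (tables (dim V))"
      unfolding tables.simps[of "dim V"] by force
    with P show ?thesis by blast
  qed
qed

lemma isomorphic_listed:
  assumes dim: "dim UNIV = 4" and indep: "indep_list [b1, b2, b3, b4]"
    and \<beta>: "\<beta> = (\<lambda>i::4. if i = 1 then b1 else if i = 2 then b2 else if i = 3 then b3 else b4)"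
    and prod: "\<And>i j. \<beta> i \<odot> \<beta> j = (\<Sum>k\<in>UNIV. (basis_product (product_tables ! (n - 1)) i j $ k) \<cdot> \<beta> k)"
  shows "isomorphic_algebras scale mul (*s) (listed_mult n)"
proof -
  let ?T = "product_tables ! (n - 1)"
  define g where "g x = (\<Sum>k\<in>UNIV. (x $ k) \<cdot> \<beta> k)" for x :: "complex ^ 4"
  have lin: "Vector_Spaces.linear (*s) scale g"
    unfolding Vector_Spaces.linear_iff
    by (auto simp: g_def vec.vector_space_axioms vector_space_axioms scale_left_distrib sum.distrib scale_sum_right)
  interpret g: Vector_Spaces.linear "(*s)" scale g by fact
  have g4: "g x = (x $ 1) \<cdot> b1 + (x $ 2) \<cdot> b2 + (x $ 3) \<cdot> b3 + (x $ 4) \<cdot> b4" for x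
    by (simp add: g_def sum_4 \<beta>)
  have span: "span (set [b1, b2, b3, b4]) = UNIV"
    using indep_list_spans[OF indep, of UNIV] dim by simp
  have "surj g"
  proof (rule surjI[of _ "\<lambda>v. SOME x. g x = v"])
    fix v
    have "v \<in> span (set [b1, b2, b3, b4])" using span by simp
    then obtain p q r s where "v = p \<cdot> b1 + q \<cdot> b2 + r \<cdot> b3 + s \<cdot> b4" by (rule span_list4E)
    then have "g (V4 p q r s) = v" by (simp add: g4)
    then show "g (SOME x. g x = v) = v" by (rule someI)
  qed
  moreover have "inj g"
  proof -
    have head: "c = 0" if "c \<cdot> b + w = 0" "w \<in> span S" "b \<notin> span S" for c b w S
    proof (rule ccontr)
      assume "c \<noteq> 0"
      moreover have "c \<cdot> b = - w" using that(1) by (simp add: add_eq_0_iff)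
      then have "c \<cdot> b \<in> span S" using that(2) by (simp add: span_neg)
      ultimately show False using that(3) span_scaled by blast
    qed
    have "x = 0" if "g x = 0" for x
    proof -
      have 0: "(x $ 1) \<cdot> b1 + ((x $ 2) \<cdot> b2 + ((x $ 3) \<cdot> b3 + (x $ 4) \<cdot> b4)) = 0"
        using that by (simp add: g4 add.assoc)
      have 1: "x $ 1 = 0"
        by (rule head[OF 0, of "{b2, b3, b4}"]) (use indep in \<open>auto intro!: span_add span_scale intro: span_base\<close>)
      have 2: "x $ 2 = 0"
        by (rule head[of _ b2 "(x $ 3) \<cdot> b3 + (x $ 4) \<cdot> b4" "{b3, b4}"])
           (use 0 1 indep in \<open>auto intro!: span_add span_scale intro: span_base\<close>)
      have 3: "x $ 3 = 0"
        by (rule head[of _ b3 "(x $ 4) \<cdot> b4" "{b4}"])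
           (use 0 1 2 indep in \<open>auto intro!: span_add span_scale intro: span_base\<close>)
      have 4: "x $ 4 = 0" using 0 1 2 3 indep by (simp add: span_empty)
      show ?thesis using 1 2 3 4 by (simp add: vec_eq_iff forall_4)
    qed
    then show ?thesis by (intro injI) (metis g.diff eq_iff_diff_eq_0)
  qed
  ultimately have "bij g" by (rule bijI[rotated])
  have ginv: "g (inv g v) = v" "inv g (g x) = x" for v x
    using \<open>bij g\<close> by (simp_all add: bij_is_inj bij_is_surj surj_f_inv_f)
  have mul_sum: "(\<Sum>i\<in>A. h i) \<odot> y = (\<Sum>i\<in>A. h i \<odot> y)" "y \<odot> (\<Sum>i\<in>A. h i) = (\<Sum>i\<in>A. y \<odot> h i)"
    for h :: "4 \<Rightarrow> 'a" and A y
    by (induction A rule: infinite_finite_induct; simp add: mul_add)+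
  have hom: "g (listed_mult n x y) = g x \<odot> g y" for x y
  proof -
    have "g (listed_mult n x y) = (\<Sum>i\<in>UNIV. \<Sum>j\<in>UNIV. (x $ i * y $ j) \<cdot> g (basis_product ?T i j))"
      by (simp add: listed_mult_def table_mult_def g.sum g.scale)
    also have "\<dots> = (\<Sum>i\<in>UNIV. \<Sum>j\<in>UNIV. (x $ i * y $ j) \<cdot> (\<beta> i \<odot> \<beta> j))"
      by (simp only: prod g_def)
    also have "\<dots> = g x \<odot> g y"
      by (simp add: g_def mul_sum mul_scale scale_sum_right mult.commute) (rule sum.swap)
    finally show ?thesis .
  qed
  have "inv g (x + y) = inv g x + inv g y" for x y
    by (metis ginv g.add)
  moreover have "inv g (c \<cdot> x) = c *s inv g x" for c x
    by (metis ginv g.scale)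
  ultimately have "Vector_Spaces.linear scale (*s) (inv g)"
    by (simp add: Vector_Spaces.linear_iff vec.vector_space_axioms vector_space_axioms)
  moreover have "inv g (x \<odot> y) = listed_mult n (inv g x) (inv g y)" for x y
    by (metis ginv hom)
  ultimately show ?thesis
    unfolding isomorphic_algebras_def using bij_imp_bij_inv[OF \<open>bij g\<close>] by blast
qed

end

definition position :: "nat list \<Rightarrow> 4 \<Rightarrow> nat" where
  "position p i = p ! (if i = 1 then 0 else if i = 2 then 1 else if i = 3 then 2 else 3)"

text \<open>The list \<open>p\<close> holds the positions of \<open>e\<^sub>1, \<dots>, e\<^sub>4\<close> in a presenting basis.\<close>

definition matches :: "nat \<Rightarrow> nat list \<Rightarrow> monomial_table \<Rightarrow> bool" where
  "matches n p T \<longleftrightarrow> (\<forall>i j. case T (position p i) (position p j) of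
      None \<Rightarrow> basis_product (product_tables ! (n - 1)) i j = 0
    | Some k \<Rightarrow> \<exists>l. position p l = k \<and> basis_product (product_tables ! (n - 1)) i j = ee l)"

text \<open>The entries run parallel to \<open>tables 4\<close>: the number in the list, and the order in which the presenting
basis has to be read.\<close>

definition identification :: "(nat \<times> nat list) list" where
  "identification = [
     (1, [0, 1, 2, 3]), (2, [0, 1, 2, 3]), (3, [0, 1, 2, 3]), (7, [0, 1, 2, 3]), (4, [0, 1, 2, 3]),
     (8, [0, 1, 2, 3]), (9, [0, 1, 2, 3]), (6, [0, 1, 2, 3]), (5, [0, 1, 2, 3]), (27, [0, 1, 2, 3]),
     (29, [0, 1, 2, 3]), (28, [0, 1, 2, 3]), (30, [0, 1, 2, 3]), (23, [0, 1, 2, 3]), (24, [0, 1, 2, 3]),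
     (19, [0, 1, 2, 3]), (10, [0, 1, 2, 3]), (11, [0, 1, 2, 3]), (20, [0, 1, 2, 3]), (11, [0, 3, 1, 2]),
     (13, [0, 1, 2, 3]), (14, [0, 1, 2, 3]), (25, [0, 1, 2, 3]), (26, [0, 1, 2, 3]), (20, [2, 0, 1, 3]),
     (11, [2, 3, 0, 1]), (12, [0, 1, 2, 3]), (21, [0, 1, 2, 3]), (13, [3, 0, 1, 2]), (22, [0, 1, 2, 3]),
     (14, [3, 0, 1, 2]), (15, [0, 1, 2, 3]), (16, [0, 1, 2, 3]), (18, [0, 1, 2, 3]), (17, [0, 1, 2, 3])]"

lemma ex_4: "(\<exists>l::4. P l) \<longleftrightarrow> P 1 \<or> P 2 \<or> P 3 \<or> P 4"
  using forall_4[of "\<lambda>l. \<not> P l"] by blast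

lemma ee_eq_iff [simp]: "ee i = ee j \<longleftrightarrow> i = j" and ee_nonzero [simp]: "ee i \<noteq> 0" "0 \<noteq> ee i"
  by (simp_all add: ee_def axis_eq_axis axis_eq_0_iff eq_commute[of 0])

lemma upt_small: "[0..<0::nat] = []" "[0..<Suc 0] = [0::nat]" "[0..<2] = [0,Suc 0]" "[0..<3] = [0,Suc 0,2]"
  "[0..<4] = [0,Suc 0,2,3]"
  by (simp_all add: upt_rec)

text \<open>The recursion equation may not be used as a rewrite rule, as it would unfold forever under the
binder of \<open>m\<close>; the levels are therefore evaluated one after another.\<close>

lemmas tables_0 = tables.simps[of 0, simplified nil_tables_def upt_small list.map, simplified]
lemmas tables_1 = tables.simps[of "Suc 0", simplified nil_tables_def upt_small list.map, simplified, simplified tables_0, simplified]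
lemmas tables_2 = tables.simps[of 2, simplified nil_tables_def upt_small list.map, simplified, simplified tables_0 tables_1, simplified]
lemmas tables_3 = tables.simps[of 3, simplified nil_tables_def upt_small list.map, simplified, simplified tables_0 tables_1 tables_2, simplified]
lemmas tables_4 = tables.simps[of 4, simplified nil_tables_def upt_small list.map, simplified, simplified tables_0 tables_1 tables_2 tables_3, simplified]

lemma tables_identified:
  "list_all2 (\<lambda>T (n, p). n \<in> {1..30} \<and> distinct p \<and> set p = {0,1,2,3} \<and> 
      (if n = 5 then T = entry [(0,0,2), (1,1,3)]
       else if n = 28 then T = split_table 0 (entry []) (entry [(0,0,2), (1,1,2)])
       else matches n p T)) (tables 4) identification"
  by (simp add: tables_4 identification_def matches_def forall_4 ex_4 position_def split_table_def
      product_tables_def basis_product_def insert_commute)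

context findim_comm_algebra begin

lemma matches_isomorphic:
  assumes P: "presents UNIV vs T" and dim: "dim UNIV = 4"
    and m: "matches n p T" and p: "distinct p" "set p = {0,1,2,3}"
  shows "isomorphic_algebras scale mul (*s) (listed_mult n)"
proof -
  have vs: "indep_list vs" "length vs = 4"
    using P presents_dim[OF P] unfolding presents_def dim by blast+
  have prod: "vs ! i \<odot> vs ! j = basis_value vs (T i j)" if "i < 4" "j < 4" for i j
    using P that unfolding presents_def vs(2) by blast
  have "length p = 4" using distinct_card[OF p(1)] p(2) by simp
  then obtain a b c d where p': "p = [a, b, c, d]"
    by (auto simp: numeral_eq_Suc length_Suc_conv)
  have lt: "k < 4" if "k \<in> set p" for k using that unfolding p(2) by auto
  define \<beta> where "\<beta> i = vs ! position p i" for i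
  have pos: "position p i < 4" for i
    using lt by (simp add: position_def p')
  have "set [vs ! a, vs ! b, vs ! c, vs ! d] = (!) vs ` set p" by (simp add: p')
  also have "\<dots> = (!) vs ` {..<length vs}" unfolding p(2) vs(2) by (intro arg_cong[where f = "image _"]) auto
  also have "\<dots> = set vs" by (auto simp: set_conv_nth)
  finally have "indep_list [vs ! a, vs ! b, vs ! c, vs ! d]"
    by (rule indep_list_cong[OF vs(1)]) (simp add: vs(2))
  then show ?thesis
  proof (rule isomorphic_listed[OF dim])
    show "\<beta> = (\<lambda>i. if i = 1 then vs ! a else if i = 2 then vs ! b else if i = 3 then vs ! c else vs ! d)"
      by (auto simp: \<beta>_def position_def p')
    show "\<beta> i \<odot> \<beta> j = (\<Sum>k\<in>UNIV. (basis_product (product_tables ! (n - 1)) i j $ k) \<cdot> \<beta> k)" for i j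
    proof (cases "T (position p i) (position p j)")
      case None
      then have "basis_product (product_tables ! (n - 1)) i j = 0"
        using m[unfolded matches_def, rule_format, of i j] by simp
      then show ?thesis using prod[OF pos pos, of i j] None by (simp add: \<beta>_def)
    next
      case (Some k)
      then obtain l where l: "position p l = k" "basis_product (product_tables ! (n - 1)) i j = ee l"
        using m[unfolded matches_def, rule_format, of i j] by auto
      have "(\<Sum>k\<in>UNIV. (ee l $ k) \<cdot> \<beta> k) = (\<Sum>k\<in>UNIV. if k = l then \<beta> k else 0)"
        by (intro sum.cong) (auto simp: ee_def axis_def)
      then show ?thesis using prod[OF pos pos, of i j] Some l by (simp add: \<beta>_def)
    qed
  qed
qed

lemma presents_4E:
  assumes "presents UNIV vs T" "dim UNIV = 4"
  obtains a b c d where "vs = [a, b, c, d]" "indep_list vs"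
    "\<And>i j. i < 4 \<Longrightarrow> j < 4 \<Longrightarrow> vs ! i \<odot> vs ! j = basis_value vs (T i j)"
proof -
  have vs: "indep_list vs" "length vs = 4"
    using assms(1) presents_dim[OF assms(1)] unfolding presents_def assms(2) by blast+
  moreover have "vs ! i \<odot> vs ! j = basis_value vs (T i j)" if "i < 4" "j < 4" for i j
    using assms(1) that unfolding presents_def vs(2) by blast
  moreover obtain a b c d where "vs = [a, b, c, d]"
    using vs(2) by (auto simp: numeral_eq_Suc length_Suc_conv)
  ultimately show thesis using that by blast
qed

text \<open>The presenting basis has \<open>ab = 0\<close>, and the listed one \<open>e\<^sub>1\<^sup>2 + e\<^sub>2\<^sup>2 = 0\<close>: both say that the quadratic
relation has rank two.\<close>

lemma isomorphic_5:
  assumes P: "presents UNIV vs (entry [(0,0,2), (1,1,3)])" and dim: "dim UNIV = 4"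
  shows "isomorphic_algebras scale mul (*s) (listed_mult 5)"
proof -
  obtain a b s t where vs: "vs = [a, b, s, t]" "indep_list vs"
    and prod: "\<And>i j. i < 4 \<Longrightarrow> j < 4 \<Longrightarrow> vs ! i \<odot> vs ! j = basis_value vs (entry [(0,0,2), (1,1,3)] i j)"
    using presents_4E[OF P dim] by metis
  have products: "a \<odot> a = s" "b \<odot> b = t" "a \<odot> b = 0" "b \<odot> a = 0"
    "a \<odot> s = 0" "a \<odot> t = 0" "b \<odot> s = 0" "b \<odot> t = 0" "s \<odot> s = 0" "t \<odot> t = 0" "s \<odot> t = 0"
    "s \<odot> a = 0" "t \<odot> a = 0" "s \<odot> b = 0" "t \<odot> b = 0" "t \<odot> s = 0"
    using prod[of 0 0] prod[of 1 1] prod[of 0 1] prod[of 1 0] prod[of 0 2] prod[of 0 3] prod[of 1 2] prod[of 1 3]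
      prod[of 2 2] prod[of 3 3] prod[of 2 3] prod[of 2 0] prod[of 3 0] prod[of 2 1] prod[of 3 1] prod[of 3 2]
    by (simp_all add: vs)
  let ?e1 = "a + b" and ?e2 = "\<i> \<cdot> (a - b)" and ?e3 = "- (s + t)" and ?e4 = "\<i> \<cdot> (s - t)"
  let ?S = "span (set [?e1, ?e2, ?e3, ?e4])"
  have gen: "?e1 \<in> ?S" "?e2 \<in> ?S" "?e3 \<in> ?S" "?e4 \<in> ?S" by (simp_all add: span_base)
  have half: "x \<in> ?S \<and> y \<in> ?S" if "x + y \<in> ?S" "\<i> \<cdot> (x - y) \<in> ?S" for x y
  proof -
    have d: "x - y \<in> ?S" using that(2) by (subst (asm) span_scaled) simp_all
    have "2 \<cdot> x = (x + y) + (x - y)" "2 \<cdot> y = (x + y) - (x - y)"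
      using scale_left_distrib[of 1 1 x] scale_left_distrib[of 1 1 y] by simp_all
    then have "2 \<cdot> x \<in> ?S" "2 \<cdot> y \<in> ?S" using d that(1) by (simp_all only: span_add span_diff)
    then show ?thesis using span_scaled[of 2 x] span_scaled[of 2 y] by simp
  qed
  have "a \<in> ?S" "b \<in> ?S" using half[OF gen(1,2)] by simp_all
  moreover have "s + t \<in> ?S" using span_neg[OF gen(3)] by (simp only: minus_minus)
  then have "s \<in> ?S" "t \<in> ?S" using half[OF _ gen(4)] by simp_all
  ultimately have "set [a, b, s, t] \<subseteq> ?S" by simp
  then have "span (set [a, b, s, t]) \<subseteq> ?S" by (rule span_minimal) simp
  moreover have "span (set [a, b, s, t]) = UNIV" using P unfolding presents_def vs(1) by blast
  ultimately have "UNIV \<subseteq> ?S" by simp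
  then have "indep_list [?e1, ?e2, ?e3, ?e4]"
    using dim by (intro spanning_indep_list[of _ UNIV]) simp_all
  then show ?thesis
  proof (rule isomorphic_listed[OF dim _ refl])
    show "(if i = 1 then ?e1 else if i = 2 then ?e2 else if i = 3 then ?e3 else ?e4) \<odot>
        (if j = 1 then ?e1 else if j = 2 then ?e2 else if j = 3 then ?e3 else ?e4) =
        (\<Sum>k\<in>UNIV. (basis_product (product_tables ! (5 - 1)) i j $ k) \<cdot>
          (if k = 1 then ?e1 else if k = 2 then ?e2 else if k = 3 then ?e3 else ?e4))" for i j
      using exhaust_4[of i] exhaust_4[of j]
      by (elim disjE; simp add: sum_4 basis_product_def product_tables_def ee_def axis_def mul_distribs products
          scale_right_diff_distrib)
  qed
qed

text \<open>The presenting basis has the form \<open>a\<^sup>2 + b\<^sup>2\<close>, and the listed one the hyperbolic form; the isotropic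
vectors \<open>a \<plusminus> \<i>b\<close> lead from one to the other.\<close>

lemma isomorphic_28:
  assumes P: "presents UNIV vs (split_table 0 (entry []) (entry [(0,0,2), (1,1,2)]))" and dim: "dim UNIV = 4"
  shows "isomorphic_algebras scale mul (*s) (listed_mult 28)"
proof -
  let ?T = "split_table 0 (entry []) (entry [(0,0,2), (1,1,2)])"
  obtain e a b t where vs: "vs = [e, a, b, t]" "indep_list vs"
    and prod: "\<And>i j. i < 4 \<Longrightarrow> j < 4 \<Longrightarrow> vs ! i \<odot> vs ! j = basis_value vs (?T i j)"
    using presents_4E[OF P dim] by metis
  have products: "e \<odot> e = e" "e \<odot> a = 0" "e \<odot> b = 0" "e \<odot> t = 0" "a \<odot> a = t" "b \<odot> b = t"
    "a \<odot> b = 0" "b \<odot> a = 0" "a \<odot> t = 0" "b \<odot> t = 0" "t \<odot> t = 0"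
    "a \<odot> e = 0" "b \<odot> e = 0" "t \<odot> e = 0" "t \<odot> a = 0" "t \<odot> b = 0"
    using prod[of 0 0] prod[of 0 1] prod[of 0 2] prod[of 0 3] prod[of 1 1] prod[of 2 2] prod[of 1 2] prod[of 2 1]
      prod[of 1 3] prod[of 2 3] prod[of 3 3] prod[of 1 0] prod[of 2 0] prod[of 3 0] prod[of 3 1] prod[of 3 2]
    by (simp_all add: vs split_table_def)
  let ?e2 = "a + \<i> \<cdot> b" and ?e3 = "a - \<i> \<cdot> b" and ?e4 = "2 \<cdot> t"
  let ?S = "span (set [e, ?e2, ?e3, ?e4])"
  have gen: "e \<in> ?S" "?e2 \<in> ?S" "?e3 \<in> ?S" "?e4 \<in> ?S" by (simp_all add: span_base)
  have two: "2 \<cdot> x = x + x" for x using scale_left_distrib[of 1 1 x] by simp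
  have "2 \<cdot> a = ?e2 + ?e3" "(2 * \<i>) \<cdot> b = ?e2 - ?e3"
    using scale_left_distrib[of \<i> \<i> b] by (simp_all add: two)
  then have "2 \<cdot> a \<in> ?S" "(2 * \<i>) \<cdot> b \<in> ?S" using gen by (simp_all only: span_add span_diff)
  then have "a \<in> ?S" "b \<in> ?S" using span_scaled[of 2 a] span_scaled[of "2 * \<i>" b] by simp_all
  moreover have "t \<in> ?S" using gen(4) span_scaled[of 2 t] by simp
  ultimately have "set [e, a, b, t] \<subseteq> ?S" using gen(1) by simp
  then have "span (set [e, a, b, t]) \<subseteq> ?S" by (rule span_minimal) simp
  moreover have "span (set [e, a, b, t]) = UNIV" using P unfolding presents_def vs(1) by blast
  ultimately have "UNIV \<subseteq> ?S" by simp
  then have "indep_list [e, ?e2, ?e3, ?e4]"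
    using dim by (intro spanning_indep_list[of _ UNIV]) simp_all
  then show ?thesis
  proof (rule isomorphic_listed[OF dim _ refl])
    show "(if i = 1 then e else if i = 2 then ?e2 else if i = 3 then ?e3 else ?e4) \<odot>
        (if j = 1 then e else if j = 2 then ?e2 else if j = 3 then ?e3 else ?e4) =
        (\<Sum>k\<in>UNIV. (basis_product (product_tables ! (28 - 1)) i j $ k) \<cdot>
          (if k = 1 then e else if k = 2 then ?e2 else if k = 3 then ?e3 else ?e4))" for i j
      using exhaust_4[of i] exhaust_4[of j]
      by (elim disjE; simp add: sum_4 basis_product_def product_tables_def ee_def axis_def mul_distribs products two)
  qed
qed

lemma isomorphic_to_listed:
  assumes dim: "dim UNIV = 4"
  shows "\<exists>n\<in>{1..30}. isomorphic_algebras scale mul (*s) (listed_mult n)"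
proof -
  have "subalgebra UNIV" by (simp add: subalgebra_def)
  then obtain vs T where T: "T \<in> set (tables 4)" and P: "presents UNIV vs T"
    using algebra_classification[of UNIV] dim by (metis order_refl)
  obtain k where k: "k < length (tables 4)" "T = tables 4 ! k"
    using T by (metis in_set_conv_nth)
  obtain n p where np: "identification ! k = (n, p)" by fastforce
  have *: "n \<in> {1..30} \<and> distinct p \<and> set p = {0,1,2,3} \<and>
      (if n = 5 then T = entry [(0,0,2), (1,1,3)]
       else if n = 28 then T = split_table 0 (entry []) (entry [(0,0,2), (1,1,2)])
       else matches n p T)"
    using list_all2_nthD[OF tables_identified k(1)] unfolding np k(2) by simp
  have "isomorphic_algebras scale mul (*s) (listed_mult n)"
    using * P isomorphic_5[OF _ dim] isomorphic_28[OF _ dim] matches_isomorphic[OF P dim]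
    by (metis (no_types, lifting))
  with * show ?thesis by blast
qed

end

section \<open>Invariants of the listed algebras\<close>

definition coordinate_plane :: "4 set \<Rightarrow> (complex ^ 4) set" where
  "coordinate_plane D = {x. \<forall>i. i \<notin> D \<longrightarrow> x $ i = 0}"

text \<open>Coordinate planes are the only subspaces of which dimensions have to be computed.\<close>

lemma dim_coordinate_plane: "vec.dim (coordinate_plane D) = card D"
  unfolding coordinate_plane_def by (rule dim_substandard_cart)

lemma table_mult_basis_expansion: "table_mult T x y = (\<Sum>i\<in>UNIV. y $ i *s table_mult T x (ee i))"
proof (rule vec_eq_iff[THEN iffD2], rule allI)
  fix k
  show "table_mult T x y $ k = (\<Sum>i\<in>UNIV. y $ i *s table_mult T x (ee i)) $ k"
    by (simp add: table_mult_coords sum_4 ee_def axis_def algebra_simps)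
qed

text \<open>The nilpotent factor of the algebra: in dimension at most four, a product of five elements of it
vanishes, while in a unital factor \<open>y\<close> can be the unit.\<close>

definition null_component :: "('a \<Rightarrow> 'a \<Rightarrow> 'a::zero) \<Rightarrow> 'a set" where
  "null_component m = {x. \<forall>y. m (m (m (m x y) y) y) y = 0}"

definition nilradical :: "('a \<Rightarrow> 'a \<Rightarrow> 'a::zero) \<Rightarrow> 'a set" where
  "nilradical m = {x. m x (m x (m x (m x x))) = 0}"

definition nil_socle :: "('a \<Rightarrow> 'a \<Rightarrow> 'a::zero) \<Rightarrow> 'a set" where
  "nil_socle m = {x \<in> nilradical m. \<forall>y \<in> nilradical m. m x y = 0}"

definition second_nil_socle :: "('a \<Rightarrow> 'a \<Rightarrow> 'a::zero) \<Rightarrow> 'a set" where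
  "second_nil_socle m = {x \<in> nilradical m. \<forall>y \<in> nilradical m. \<forall>z \<in> nilradical m. m (m x y) z = 0}"

text \<open>This measures how the elements of square zero lie; it separates the algebras that agree in the dimensions of
the other four subspaces.\<close>

definition square_zero_annihilator :: "('a \<Rightarrow> 'a \<Rightarrow> 'a::zero) \<Rightarrow> 'a set" where
  "square_zero_annihilator m = {x. \<forall>y. m y y = 0 \<longrightarrow> m x y = 0}"

definition profile :: "(complex ^ 4 \<Rightarrow> complex ^ 4 \<Rightarrow> complex ^ 4) \<Rightarrow> nat list" where
  "profile m = map vec.dim [null_component m, nilradical m, nil_socle m, second_nil_socle m]"

lemma ee_in_plane: "i \<in> D \<Longrightarrow> ee i \<in> coordinate_plane D"
  by (auto simp: coordinate_plane_def ee_def axis_def)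

text \<open>By bilinearity, annihilation of a coordinate plane is tested on its basis vectors.\<close>

lemma table_mult_plane_zero_iff:
  "(\<forall>y \<in> coordinate_plane D. table_mult T x y = 0) \<longleftrightarrow> (\<forall>i \<in> D. table_mult T x (ee i) = 0)"
proof
  assume *: "\<forall>i \<in> D. table_mult T x (ee i) = 0"
  show "\<forall>y \<in> coordinate_plane D. table_mult T x y = 0"
  proof
    fix y assume y: "y \<in> coordinate_plane D"
    have "y $ i *s table_mult T x (ee i) = 0" for i
      using * y by (cases "i \<in> D") (auto simp: coordinate_plane_def)
    then show "table_mult T x y = 0"
      unfolding table_mult_basis_expansion[of T x y] by (intro sum.neutral) blast
  qed
qed (blast intro: ee_in_plane)

lemma table_mult_plane_zero_iff2:
  "(\<forall>y \<in> coordinate_plane D. \<forall>z \<in> coordinate_plane D. table_mult T (table_mult T x y) z = 0)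
    \<longleftrightarrow> (\<forall>i \<in> D. \<forall>j \<in> D. table_mult T (table_mult T x (ee i)) (ee j) = 0)" (is "?L \<longleftrightarrow> ?R")
proof
  assume R: ?R
  show ?L
  proof (intro ballI)
    fix y z assume y: "y \<in> coordinate_plane D" and z: "z \<in> coordinate_plane D"
    have "table_mult T (y $ i *s table_mult T x (ee i)) z = 0" for i
    proof (cases "i \<in> D")
      case True
      with R z have "table_mult T (table_mult T x (ee i)) z = 0"
        using table_mult_plane_zero_iff by blast
      then show ?thesis by (simp add: table_mult_scale)
    next
      case False
      with y show ?thesis by (simp add: coordinate_plane_def table_mult_zero)
    qed
    then show "table_mult T (table_mult T x y) z = 0"
      unfolding table_mult_basis_expansion[of T x y] by (simp add: sum_4 table_mult_add)
  qed
qed (blast intro: ee_in_plane)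

text \<open>Only the null component involves a condition that is not linear in \<open>y\<close>. For it, one direction is tested
on the single vector \<open>\<epsilon>\<close>, for which the sum of the idempotent basis vectors is suitable.\<close>

lemma profile_planes:
  assumes D0: "\<And>a b c d. m (m (m (m (V4 a b c d) \<epsilon>) \<epsilon>) \<epsilon>) \<epsilon> = 0 \<Longrightarrow> V4 a b c d \<in> coordinate_plane D0"
    and D0': "\<And>a b c d a' b' c' d'. V4 a b c d \<in> coordinate_plane D0 \<Longrightarrow>
        m (m (m (m (V4 a b c d) (V4 a' b' c' d')) (V4 a' b' c' d')) (V4 a' b' c' d')) (V4 a' b' c' d') = 0"
    and D1: "\<And>a b c d. m (V4 a b c d) (m (V4 a b c d) (m (V4 a b c d) (m (V4 a b c d) (V4 a b c d)))) = 0
        \<longleftrightarrow> V4 a b c d \<in> coordinate_plane D1"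
    and D2: "\<And>a b c d. V4 a b c d \<in> coordinate_plane D2 \<longleftrightarrow>
        V4 a b c d \<in> coordinate_plane D1 \<and> (\<forall>i\<in>D1. m (V4 a b c d) (ee i) = 0)"
    and D3: "\<And>a b c d. V4 a b c d \<in> coordinate_plane D3 \<longleftrightarrow> V4 a b c d \<in> coordinate_plane D1 \<and>
        (\<forall>i\<in>D1. \<forall>j\<in>D1. m (m (V4 a b c d) (ee i)) (ee j) = 0)"
    and p: "p = [card D0, card D1, card D2, card D3]"
    and m: "m = listed_mult n"
  shows "profile m = p"
proof -
  have 0: "null_component m = coordinate_plane D0"
  proof (rule set_eqI)
    fix x obtain a b c d where x: "x = V4 a b c d" by (rule V4_cases)
    have "m (m (m (m x y) y) y) y = 0" if "x \<in> coordinate_plane D0" for y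
      using that D0' unfolding x by (cases y rule: V4_cases) blast
    then show "x \<in> null_component m \<longleftrightarrow> x \<in> coordinate_plane D0"
      unfolding null_component_def using D0[of a b c d] x by blast
  qed
  have 1: "nilradical m = coordinate_plane D1"
  proof (rule set_eqI)
    fix x obtain a b c d where x: "x = V4 a b c d" by (rule V4_cases)
    show "x \<in> nilradical m \<longleftrightarrow> x \<in> coordinate_plane D1"
      unfolding nilradical_def mem_Collect_eq x by (rule D1)
  qed
  have 2: "nil_socle m = coordinate_plane D2"
  proof (rule set_eqI)
    fix x obtain a b c d where x: "x = V4 a b c d" by (rule V4_cases)
    show "x \<in> nil_socle m \<longleftrightarrow> x \<in> coordinate_plane D2"
      unfolding nil_socle_def 1 mem_Collect_eq x D2
      unfolding m listed_mult_def table_mult_plane_zero_iff ..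
  qed
  have 3: "second_nil_socle m = coordinate_plane D3"
  proof (rule set_eqI)
    fix x obtain a b c d where x: "x = V4 a b c d" by (rule V4_cases)
    show "x \<in> second_nil_socle m \<longleftrightarrow> x \<in> coordinate_plane D3"
      unfolding second_nil_socle_def 1 mem_Collect_eq x D3
      unfolding m listed_mult_def table_mult_plane_zero_iff2 ..
  qed
  show ?thesis by (simp add: p profile_def 0 1 2 3 dim_coordinate_plane)
qed

lemma in_plane_V4: "V4 a b c d \<in> coordinate_plane D \<longleftrightarrow>
   (1 \<notin> D \<longrightarrow> a = 0) \<and> (2 \<notin> D \<longrightarrow> b = 0) \<and> (3 \<notin> D \<longrightarrow> c = 0) \<and> (4 \<notin> D \<longrightarrow> d = 0)"
  by (simp add: coordinate_plane_def forall_4)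
lemmas V4_simps = V4_eq_0_iff V4_add ee_V4 in_plane_V4

lemma profile_1: "profile (listed_mult 1) = [4, 4, 4, 4]"
  by (rule profile_planes[where \<epsilon> = "V4 0 0 0 0" and ?D0.0 = "{1,2,3,4}" and ?D1.0 = "{1,2,3,4}" and ?D2.0 = "{1,2,3,4}"
        and ?D3.0 = "{1,2,3,4}"];
      (auto simp add: V4_simps listed_mult_V4 simp del: One_nat_def))

lemma profile_2: "profile (listed_mult 2) = [4, 4, 3, 4]"
  by (rule profile_planes[where \<epsilon> = "V4 0 0 0 0" and ?D0.0 = "{1,2,3,4}" and ?D1.0 = "{1,2,3,4}" and ?D2.0 = "{2,3,4}"
        and ?D3.0 = "{1,2,3,4}"];
      (auto simp add: V4_simps listed_mult_V4 simp del: One_nat_def))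

lemma profile_3: "profile (listed_mult 3) = [4, 4, 2, 4]"
  by (rule profile_planes[where \<epsilon> = "V4 0 0 0 0" and ?D0.0 = "{1,2,3,4}" and ?D1.0 = "{1,2,3,4}" and ?D2.0 = "{3,4}"
        and ?D3.0 = "{1,2,3,4}"];
      (auto simp add: V4_simps listed_mult_V4 simp del: One_nat_def))

lemma profile_4: "profile (listed_mult 4) = [4, 4, 2, 3]"
  by (rule profile_planes[where \<epsilon> = "V4 0 0 0 0" and ?D0.0 = "{1,2,3,4}" and ?D1.0 = "{1,2,3,4}" and ?D2.0 = "{3,4}"
        and ?D3.0 = "{2,3,4}"];
      (auto simp add: V4_simps listed_mult_V4 simp del: One_nat_def))

lemma profile_5: "profile (listed_mult 5) = [4, 4, 2, 4]"
  by (rule profile_planes[where \<epsilon> = "V4 0 0 0 0" and ?D0.0 = "{1,2,3,4}" and ?D1.0 = "{1,2,3,4}" and ?D2.0 = "{3,4}"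
        and ?D3.0 = "{1,2,3,4}"];
      (auto simp add: V4_simps listed_mult_V4 simp del: One_nat_def))

lemma profile_6: "profile (listed_mult 6) = [4, 4, 2, 4]"
  by (rule profile_planes[where \<epsilon> = "V4 0 0 0 0" and ?D0.0 = "{1,2,3,4}" and ?D1.0 = "{1,2,3,4}" and ?D2.0 = "{3,4}"
        and ?D3.0 = "{1,2,3,4}"];
      (auto simp add: V4_simps listed_mult_V4 simp del: One_nat_def))

lemma profile_7: "profile (listed_mult 7) = [4, 4, 1, 4]"
  by (rule profile_planes[where \<epsilon> = "V4 0 0 0 0" and ?D0.0 = "{1,2,3,4}" and ?D1.0 = "{1,2,3,4}" and ?D2.0 = "{4}"
        and ?D3.0 = "{1,2,3,4}"];
      (auto simp add: V4_simps listed_mult_V4 simp del: One_nat_def))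

lemma profile_8: "profile (listed_mult 8) = [4, 4, 1, 3]"
  by (rule profile_planes[where \<epsilon> = "V4 0 0 0 0" and ?D0.0 = "{1,2,3,4}" and ?D1.0 = "{1,2,3,4}" and ?D2.0 = "{4}"
        and ?D3.0 = "{2,3,4}"];
      (auto simp add: V4_simps listed_mult_V4 simp del: One_nat_def))

lemma profile_9: "profile (listed_mult 9) = [4, 4, 1, 2]"
  by (rule profile_planes[where \<epsilon> = "V4 0 0 0 0" and ?D0.0 = "{1,2,3,4}" and ?D1.0 = "{1,2,3,4}" and ?D2.0 = "{4}"
        and ?D3.0 = "{3,4}"];
      (auto simp add: V4_simps listed_mult_V4 simp del: One_nat_def))

lemma profile_10: "profile (listed_mult 10) = [0, 0, 0, 0]"
  by (rule profile_planes[where \<epsilon> = "ee 1+ee 2+ee 3+ee 4" and ?D0.0 = "{}" and ?D1.0 = "{}" and ?D2.0 = "{}"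
        and ?D3.0 = "{}"];
      (auto simp add: V4_simps listed_mult_V4 simp del: One_nat_def))

lemma profile_11: "profile (listed_mult 11) = [0, 1, 1, 1]"
  by (rule profile_planes[where \<epsilon> = "ee 1+ee 2+ee 3" and ?D0.0 = "{}" and ?D1.0 = "{4}" and ?D2.0 = "{4}"
        and ?D3.0 = "{4}"];
      (auto simp add: V4_simps listed_mult_V4 simp del: One_nat_def))

lemma profile_12: "profile (listed_mult 12) = [0, 2, 2, 2]"
  by (rule profile_planes[where \<epsilon> = "ee 1+ee 3" and ?D0.0 = "{}" and ?D1.0 = "{2,4}" and ?D2.0 = "{2,4}"
        and ?D3.0 = "{2,4}"];
      (auto simp add: V4_simps listed_mult_V4 simp del: One_nat_def))

lemma profile_13: "profile (listed_mult 13) = [0, 2, 2, 2]"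
  by (rule profile_planes[where \<epsilon> = "ee 1+ee 2" and ?D0.0 = "{}" and ?D1.0 = "{3,4}" and ?D2.0 = "{3,4}"
        and ?D3.0 = "{3,4}"];
      (auto simp add: V4_simps listed_mult_V4 simp del: One_nat_def))

lemma profile_14: "profile (listed_mult 14) = [0, 2, 1, 2]"
  by (rule profile_planes[where \<epsilon> = "ee 1+ee 2" and ?D0.0 = "{}" and ?D1.0 = "{3,4}" and ?D2.0 = "{4}"
        and ?D3.0 = "{3,4}"];
      (auto simp add: V4_simps listed_mult_V4 simp del: One_nat_def))

lemma profile_15: "profile (listed_mult 15) = [0, 3, 3, 3]"
  by (rule profile_planes[where \<epsilon> = "ee 1" and ?D0.0 = "{}" and ?D1.0 = "{2,3,4}" and ?D2.0 = "{2,3,4}"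
        and ?D3.0 = "{2,3,4}"];
      (auto simp add: V4_simps listed_mult_V4 simp del: One_nat_def))

lemma profile_16: "profile (listed_mult 16) = [0, 3, 2, 3]"
  by (rule profile_planes[where \<epsilon> = "ee 1" and ?D0.0 = "{}" and ?D1.0 = "{2,3,4}" and ?D2.0 = "{3,4}"
        and ?D3.0 = "{2,3,4}"];
      (auto simp add: V4_simps listed_mult_V4 simp del: One_nat_def))

lemma profile_17: "profile (listed_mult 17) = [0, 3, 1, 2]"
  by (rule profile_planes[where \<epsilon> = "ee 1" and ?D0.0 = "{}" and ?D1.0 = "{2,3,4}" and ?D2.0 = "{4}"
        and ?D3.0 = "{3,4}"];
      (auto simp add: V4_simps listed_mult_V4 simp del: One_nat_def))

lemma profile_18: "profile (listed_mult 18) = [0, 3, 1, 3]"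
  by (rule profile_planes[where \<epsilon> = "ee 1" and ?D0.0 = "{}" and ?D1.0 = "{2,3,4}" and ?D2.0 = "{4}"
        and ?D3.0 = "{2,3,4}"];
      (auto simp add: V4_simps listed_mult_V4 simp del: One_nat_def))

lemma profile_19: "profile (listed_mult 19) = [1, 1, 1, 1]"
  by (rule profile_planes[where \<epsilon> = "ee 1+ee 2+ee 3" and ?D0.0 = "{4}" and ?D1.0 = "{4}" and ?D2.0 = "{4}"
        and ?D3.0 = "{4}"];
      (auto simp add: V4_simps listed_mult_V4 simp del: One_nat_def))

lemma profile_20: "profile (listed_mult 20) = [1, 2, 2, 2]"
  by (rule profile_planes[where \<epsilon> = "ee 1+ee 2" and ?D0.0 = "{4}" and ?D1.0 = "{3,4}" and ?D2.0 = "{3,4}"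
        and ?D3.0 = "{3,4}"];
      (auto simp add: V4_simps listed_mult_V4 simp del: One_nat_def))

lemma profile_21: "profile (listed_mult 21) = [1, 3, 3, 3]"
  by (rule profile_planes[where \<epsilon> = "ee 1" and ?D0.0 = "{4}" and ?D1.0 = "{2,3,4}" and ?D2.0 = "{2,3,4}"
        and ?D3.0 = "{2,3,4}"];
      (auto simp add: V4_simps listed_mult_V4 simp del: One_nat_def))

lemma profile_22: "profile (listed_mult 22) = [1, 3, 2, 3]"
  by (rule profile_planes[where \<epsilon> = "ee 1" and ?D0.0 = "{4}" and ?D1.0 = "{2,3,4}" and ?D2.0 = "{3,4}"
        and ?D3.0 = "{2,3,4}"];
      (auto simp add: V4_simps listed_mult_V4 simp del: One_nat_def))

lemma profile_23: "profile (listed_mult 23) = [2, 2, 2, 2]"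
  by (rule profile_planes[where \<epsilon> = "ee 1+ee 2" and ?D0.0 = "{3,4}" and ?D1.0 = "{3,4}" and ?D2.0 = "{3,4}"
        and ?D3.0 = "{3,4}"];
      (auto simp add: V4_simps listed_mult_V4 simp del: One_nat_def))

lemma profile_24: "profile (listed_mult 24) = [2, 2, 1, 2]"
  by (rule profile_planes[where \<epsilon> = "ee 1+ee 2" and ?D0.0 = "{3,4}" and ?D1.0 = "{3,4}" and ?D2.0 = "{4}"
        and ?D3.0 = "{3,4}"];
      (auto simp add: V4_simps listed_mult_V4 simp del: One_nat_def))

lemma profile_25: "profile (listed_mult 25) = [2, 3, 3, 3]"
  by (rule profile_planes[where \<epsilon> = "ee 1" and ?D0.0 = "{3,4}" and ?D1.0 = "{2,3,4}" and ?D2.0 = "{2,3,4}"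
        and ?D3.0 = "{2,3,4}"];
      (auto simp add: V4_simps listed_mult_V4 simp del: One_nat_def))

lemma profile_26: "profile (listed_mult 26) = [2, 3, 2, 3]"
  by (rule profile_planes[where \<epsilon> = "ee 1" and ?D0.0 = "{3,4}" and ?D1.0 = "{2,3,4}" and ?D2.0 = "{2,4}"
        and ?D3.0 = "{2,3,4}"];
      (auto simp add: V4_simps listed_mult_V4 simp del: One_nat_def))

lemma profile_27: "profile (listed_mult 27) = [3, 3, 3, 3]"
  by (rule profile_planes[where \<epsilon> = "ee 1" and ?D0.0 = "{2,3,4}" and ?D1.0 = "{2,3,4}" and ?D2.0 = "{2,3,4}"
        and ?D3.0 = "{2,3,4}"];
      (auto simp add: V4_simps listed_mult_V4 simp del: One_nat_def))

lemma profile_28: "profile (listed_mult 28) = [3, 3, 1, 3]"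
  by (rule profile_planes[where \<epsilon> = "ee 1" and ?D0.0 = "{2,3,4}" and ?D1.0 = "{2,3,4}" and ?D2.0 = "{4}"
        and ?D3.0 = "{2,3,4}"];
      (auto simp add: V4_simps listed_mult_V4 simp del: One_nat_def))

lemma profile_29: "profile (listed_mult 29) = [3, 3, 2, 3]"
  by (rule profile_planes[where \<epsilon> = "ee 1" and ?D0.0 = "{2,3,4}" and ?D1.0 = "{2,3,4}" and ?D2.0 = "{3,4}"
        and ?D3.0 = "{2,3,4}"];
      (auto simp add: V4_simps listed_mult_V4 simp del: One_nat_def))

lemma profile_30: "profile (listed_mult 30) = [3, 3, 1, 2]"
  by (rule profile_planes[where \<epsilon> = "ee 1" and ?D0.0 = "{2,3,4}" and ?D1.0 = "{2,3,4}" and ?D2.0 = "{4}"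
        and ?D3.0 = "{3,4}"];
      (auto simp add: V4_simps listed_mult_V4 simp del: One_nat_def))
lemmas profiles = profile_1 profile_2 profile_3 profile_4 profile_5 profile_6 profile_7 profile_8 profile_9 profile_10 profile_11 profile_12 profile_13 profile_14 profile_15 profile_16 profile_17 profile_18 profile_19 profile_20 profile_21 profile_22 profile_23 profile_24 profile_25 profile_26 profile_27 profile_28 profile_29 profile_30

lemma dim_eq_of_automorphism:
  fixes f :: "complex ^ 4 \<Rightarrow> complex ^ 4"
  assumes f: "Vector_Spaces.linear (*s) (*s) f" "bij f"
    and S: "\<And>x. f x \<in> S' \<longleftrightarrow> x \<in> S"
  shows "vec.dim S = vec.dim S'"
proof -
  have "f ` S = S'"
  proof
    show "f ` S \<subseteq> S'" using S by blast
    show "S' \<subseteq> f ` S"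
    proof
      fix y assume "y \<in> S'"
      moreover obtain x where "y = f x" using \<open>bij f\<close> by (metis bij_pointE)
      ultimately show "y \<in> f ` S" using S by blast
    qed
  qed
  moreover have "vec.dim (f ` S) = vec.dim S"
    using f by (intro vec.dim_image_eq) (auto intro: inj_on_subset bij_is_inj)
  ultimately show ?thesis by simp
qed

lemma square_zero_annihilator_plane:
  assumes "\<And>y. y \<in> Y \<Longrightarrow> m y y = 0"
    and "\<And>a b c d. \<forall>y \<in> Y. m (V4 a b c d) y = 0 \<Longrightarrow> V4 a b c d \<in> coordinate_plane D"
    and "\<And>a b c d a' b' c' d'. V4 a b c d \<in> coordinate_plane D \<Longrightarrow> m (V4 a' b' c' d') (V4 a' b' c' d') = 0 \<Longrightarrow>
           m (V4 a b c d) (V4 a' b' c' d') = 0"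
  shows "square_zero_annihilator m = coordinate_plane D"
proof (rule set_eqI)
  fix x obtain a b c d where x: "x = V4 a b c d" by (rule V4_cases)
  have "m x y = 0" if "x \<in> coordinate_plane D" "m y y = 0" for y
    using that assms(3) unfolding x by (cases y rule: V4_cases) blast
  then show "x \<in> square_zero_annihilator m \<longleftrightarrow> x \<in> coordinate_plane D"
    unfolding square_zero_annihilator_def using assms(1) assms(2)[of a b c d] x by blast
qed

text \<open>These are the algebras whose profiles collide. In number 3 the elements \<open>e\<^sub>1 \<plusminus> \<i>e\<^sub>2\<close> of square zero
span the plane of \<open>e\<^sub>1, e\<^sub>2\<close>; in number 6 the elements of square zero are, up to the annihilator, the
multiples of \<open>e\<^sub>1\<close>, and in number 5 all of them annihilate the algebra. In number 12 they lie in two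
local factors, and in number 13 in one.\<close>

lemma square_zero_annihilator_3_5_6_12_13:
  "square_zero_annihilator (listed_mult 3) = coordinate_plane {3,4}"
  "square_zero_annihilator (listed_mult 5) = coordinate_plane {1,2,3,4}"
  "square_zero_annihilator (listed_mult 6) = coordinate_plane {1,3,4}"
  "square_zero_annihilator (listed_mult 12) = coordinate_plane {2,4}"
  "square_zero_annihilator (listed_mult 13) = coordinate_plane {1,3,4}"
proof -
  have 3: "a = 0 \<and> b = 0" if "a + b * \<i> = 0" "a - b * \<i> = 0" for a b :: complex
  proof -
    have "2 * a = (a + b * \<i>) + (a - b * \<i>)" by (simp only: algebra_simps) simp
    with that show ?thesis by simp
  qed
  show "square_zero_annihilator (listed_mult 3) = coordinate_plane {3,4}"
    by (rule square_zero_annihilator_plane[where Y = "{V4 1 \<i> 0 0, V4 1 (-\<i>) 0 0}"];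
        auto simp: listed_mult_V4 V4_simps dest: 3)
  have 5: "p = 0 \<and> q = 0" if "q * q = p * p" "p * q + q * p = 0" for p q :: complex
    using that by auto
  show "square_zero_annihilator (listed_mult 5) = coordinate_plane {1,2,3,4}"
    by (rule square_zero_annihilator_plane[where Y = "{}"];
        auto simp: listed_mult_V4 V4_simps mult.commute)
  show "square_zero_annihilator (listed_mult 6) = coordinate_plane {1,3,4}"
    by (rule square_zero_annihilator_plane[where Y = "{ee 1}"];
        auto simp: listed_mult_V4 V4_simps)
  show "square_zero_annihilator (listed_mult 12) = coordinate_plane {2,4}"
    by (rule square_zero_annihilator_plane[where Y = "{ee 2, ee 4}"];
        auto simp: listed_mult_V4 V4_simps)
  show "square_zero_annihilator (listed_mult 13) = coordinate_plane {1,3,4}"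
    by (rule square_zero_annihilator_plane[where Y = "{ee 3}"];
        auto simp: listed_mult_V4 V4_simps)
qed

text \<open>Each of the five subspaces is defined by equations in the multiplication, so an isomorphism maps it
to the corresponding subspace.\<close>

lemma isomorphic_same_invariants:
  fixes f :: "complex ^ 4 \<Rightarrow> complex ^ 4"
  assumes f: "Vector_Spaces.linear (*s) (*s) f" "bij f"
    and hom: "\<And>x y. f (m x y) = m' (f x) (f y)"
  shows "profile m = profile m'"
    and "vec.dim (square_zero_annihilator m) = vec.dim (square_zero_annihilator m')"
proof -
  have f0: "f x = 0 \<longleftrightarrow> x = 0" for x
  proof -
    have "f 0 = 0" using f(1) by (rule vec.linear_0)
    then show ?thesis using bij_is_inj[OF f(2)] by (metis injD)
  qed
  have all: "(\<forall>y. P y) \<longleftrightarrow> (\<forall>y. P (f y))" for P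
    using bij_is_surj[OF f(2)] by (metis surjD)
  note dim = dim_eq_of_automorphism[OF f]
  have 1: "f x \<in> null_component m' \<longleftrightarrow> x \<in> null_component m" for x
    unfolding null_component_def mem_Collect_eq by (subst all) (simp flip: hom add: f0)
  have 2: "f x \<in> nilradical m' \<longleftrightarrow> x \<in> nilradical m" for x
    unfolding nilradical_def by (simp flip: hom add: f0)
  have 3: "f x \<in> nil_socle m' \<longleftrightarrow> x \<in> nil_socle m" for x
    unfolding nil_socle_def mem_Collect_eq Ball_def by (subst all) (simp flip: hom add: f0 2)
  have 4: "f x \<in> second_nil_socle m' \<longleftrightarrow> x \<in> second_nil_socle m" for x
    unfolding second_nil_socle_def mem_Collect_eq Ball_def
    by (subst all, subst (2) all) (simp flip: hom add: f0 2)
  have 5: "f x \<in> square_zero_annihilator m' \<longleftrightarrow> x \<in> square_zero_annihilator m" for x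
    unfolding square_zero_annihilator_def mem_Collect_eq by (subst all) (simp flip: hom add: f0)
  show "profile m = profile m'"
    unfolding profile_def using dim[OF 1] dim[OF 2] dim[OF 3] dim[OF 4] by simp
  show "vec.dim (square_zero_annihilator m) = vec.dim (square_zero_annihilator m')"
    by (rule dim[OF 5])
qed

definition profile_table :: "(nat \<times> nat list) list" where
  "profile_table = [
     (1, [4, 4, 4, 4]),
     (2, [4, 4, 3, 4]),
     (3, [4, 4, 2, 4]),
     (4, [4, 4, 2, 3]),
     (5, [4, 4, 2, 4]),
     (6, [4, 4, 2, 4]),
     (7, [4, 4, 1, 4]),
     (8, [4, 4, 1, 3]),
     (9, [4, 4, 1, 2]),
     (10, [0, 0, 0, 0]),
     (11, [0, 1, 1, 1]),
     (12, [0, 2, 2, 2]),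
     (13, [0, 2, 2, 2]),
     (14, [0, 2, 1, 2]),
     (15, [0, 3, 3, 3]),
     (16, [0, 3, 2, 3]),
     (17, [0, 3, 1, 2]),
     (18, [0, 3, 1, 3]),
     (19, [1, 1, 1, 1]),
     (20, [1, 2, 2, 2]),
     (21, [1, 3, 3, 3]),
     (22, [1, 3, 2, 3]),
     (23, [2, 2, 2, 2]),
     (24, [2, 2, 1, 2]),
     (25, [2, 3, 3, 3]),
     (26, [2, 3, 2, 3]),
     (27, [3, 3, 3, 3]),
     (28, [3, 3, 1, 3]),
     (29, [3, 3, 2, 3]),
     (30, [3, 3, 1, 2])]"

lemma profile_listed:
  assumes "n \<in> {1..30}" shows "(n, profile (listed_mult n)) \<in> set profile_table"
  using assms unfolding nat_1_30 list.set insert_iff empty_iff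
  by (elim disjE; hypsubst?; simp add: profiles profile_table_def del: One_nat_def)

lemma profile_table_collisions:
  "\<forall>(n, p) \<in> set profile_table. \<forall>(n', p') \<in> set profile_table. p = p' \<longrightarrow>
     n = n' \<or> {n, n'} \<subseteq> {3,5,6} \<or> {n, n'} \<subseteq> {12,13}"
  unfolding profile_table_def by simp

lemma listed_invariants_separate:
  assumes n: "n \<in> {1..30}" "n' \<in> {1..30}"
    and p: "profile (listed_mult n) = profile (listed_mult n')"
    and q: "vec.dim (square_zero_annihilator (listed_mult n))
        = vec.dim (square_zero_annihilator (listed_mult n'))"
  shows "n = n'"
proof -
  have "n = n' \<or> {n, n'} \<subseteq> {3,5,6} \<or> {n, n'} \<subseteq> {12,13}"
    using profile_table_collisions profile_listed[OF n(1)] profile_listed[OF n(2)] p by blast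
  then show ?thesis
    using q by (auto simp: square_zero_annihilator_3_5_6_12_13 dim_coordinate_plane)
qed

lemma isomorphic_unique:
  assumes "isomorphic_algebras s m (*s) (listed_mult n)" "isomorphic_algebras s m (*s) (listed_mult n')"
    and "n \<in> {1..30}" "n' \<in> {1..30}"
  shows "n = n'"
proof -
  obtain f where f: "Vector_Spaces.linear s (*s) f" "bij f" "\<And>x y. f (m x y) = listed_mult n (f x) (f y)"
    using assms(1) unfolding isomorphic_algebras_def by blast
  obtain g where g: "Vector_Spaces.linear s (*s) g" "bij g" "\<And>x y. g (m x y) = listed_mult n' (g x) (g y)"
    using assms(2) unfolding isomorphic_algebras_def by blast
  interpret f: Vector_Spaces.linear s "(*s)" f by fact
  interpret g: Vector_Spaces.linear s "(*s)" g by fact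
  define h where "h = g \<circ> inv f"
  have ff: "inv f (f x) = x" "f (inv f y) = y" for x y
    using f(2) by (simp_all add: bij_is_inj bij_is_surj surj_f_inv_f)
  have "inv f (x + y) = inv f x + inv f y" for x y
    by (metis ff f.add)
  moreover have "inv f (c *s x) = s c (inv f x)" for c x
    by (metis ff f.scale)
  ultimately have lin: "Vector_Spaces.linear (*s) (*s) h"
    by (simp add: h_def Vector_Spaces.linear_iff vec.vector_space_axioms g.add g.scale)
  have "bij h"
    unfolding h_def using f(2) g(2) by (intro bij_comp bij_imp_bij_inv)
  have hom: "h (listed_mult n x y) = listed_mult n' (h x) (h y)" for x y
    by (metis h_def comp_apply ff f(3) g(3))
  show ?thesis
    by (rule listed_invariants_separate[OF assms(3,4)];
        rule isomorphic_same_invariants[OF lin \<open>bij h\<close>, of "listed_mult n" "listed_mult n'", OF hom])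
qed

section \<open>The classification\<close>

lemma comm_assoc_isomorphic_to_listed:
  fixes scale :: "complex \<Rightarrow> 'a::ab_group_add \<Rightarrow> 'a"
  assumes A: "comm_assoc_algebra scale mul" and dim: "vector_space.dim scale (UNIV :: 'a set) = 4"
  shows "\<exists>!n. n \<in> {1..30} \<and> isomorphic_algebras scale mul (*s) (listed_mult n)"
proof -
  interpret A: comm_assoc_algebra scale mul by fact
  obtain B where B: "A.independent B" "UNIV \<subseteq> A.span B" "card B = 4"
    using A.basis_exists[of UNIV] dim by metis
  have "finite B" using B(3) by (metis card.infinite zero_neq_numeral)
  then interpret findim_comm_algebra scale mul B
    using B(1,2) by unfold_locales auto
  obtain n where "n \<in> {1..30}" "isomorphic_algebras scale mul (*s) (listed_mult n)"
    using isomorphic_to_listed[OF dim] by blast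
  then show ?thesis using isomorphic_unique[of scale mul] by blast
qed

text \<open>With commutativity, \<open>(xy)z = (yx)z = (yz)x = x(yz)\<close> by right commutativity.\<close>

lemma abelian_novikov_iff:
  fixes scale :: "complex \<Rightarrow> 'a::ab_group_add \<Rightarrow> 'a"
  shows "novikov_algebra scale mul \<and> abelian_lie mul \<longleftrightarrow> comm_assoc_algebra scale mul"
proof
  assume "novikov_algebra scale mul \<and> abelian_lie mul"
  then interpret novikov_algebra scale mul by simp
  have comm: "mul x y = mul y x" for x y
    using \<open>novikov_algebra scale mul \<and> abelian_lie mul\<close> by (simp add: abelian_lie_def lie_bracket_def)
  have "mul (mul x y) z = mul x (mul y z)" for x y z
    using right_commute[of y x z] comm by metis
  with comm show "comm_assoc_algebra scale mul" by unfold_locales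
next
  assume "comm_assoc_algebra scale mul"
  then interpret comm_assoc_algebra scale mul .
  have right: "mul (mul x y) z = mul (mul x z) y" for x y z
    by (metis assoc comm)
  have "novikov_algebra scale mul"
    by unfold_locales (simp add: assoc, rule right)
  moreover have "abelian_lie mul" by (simp add: abelian_lie_def lie_bracket_def comm)
  ultimately show "novikov_algebra scale mul \<and> abelian_lie mul" by simp
qed

theorem mainTheorem3:
  fixes scale :: "complex \<Rightarrow> 'a::ab_group_add \<Rightarrow> 'a"
    and mul :: "'a \<Rightarrow> 'a \<Rightarrow> 'a"
  shows
    "(comm_assoc_algebra scale mul \<and> vector_space.dim scale (UNIV :: 'a set) = 4 \<longrightarrow>
        (\<exists>!n. n \<in> {1..30} \<and> isomorphic_algebras scale mul (*s) (listed_mult n)))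
     \<and> (novikov_algebra scale mul \<and> abelian_lie mul
          \<longleftrightarrow> comm_assoc_algebra scale mul)
     \<and> (novikov_algebra scale mul \<and> abelian_lie mul
          \<and> vector_space.dim scale (UNIV :: 'a set) = 4 \<longrightarrow>
        (\<exists>!n. n \<in> {1..30} \<and> isomorphic_algebras scale mul (*s) (listed_mult n)))
     \<and> (\<forall>n\<in>{1..30}. comm_assoc_algebra (*s) (listed_mult n)
          \<and> vector_space.dim (*s) (UNIV :: (complex ^ 4) set) = 4)"
proof (intro conjI)
  show "comm_assoc_algebra scale mul \<and> vector_space.dim scale (UNIV :: 'a set) = 4 \<longrightarrow>
        (\<exists>!n. n \<in> {1..30} \<and> isomorphic_algebras scale mul (*s) (listed_mult n))"
    using comm_assoc_isomorphic_to_listed by blast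
  then show "novikov_algebra scale mul \<and> abelian_lie mul
      \<and> vector_space.dim scale (UNIV :: 'a set) = 4 \<longrightarrow>
        (\<exists>!n. n \<in> {1..30} \<and> isomorphic_algebras scale mul (*s) (listed_mult n))"
    using abelian_novikov_iff[of scale mul] by blast
  show "novikov_algebra scale mul \<and> abelian_lie mul \<longleftrightarrow> comm_assoc_algebra scale mul"
    by (rule abelian_novikov_iff)
  have "vec.dim (UNIV :: (complex ^ 4) set) = 4" by (simp only: vec_dim_card) simp
  then show "\<forall>n\<in>{1..30}. comm_assoc_algebra (*s) (listed_mult n)
      \<and> vector_space.dim (*s) (UNIV :: (complex ^ 4) set) = 4"
    using listed_comm_assoc by blast
qed

end
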